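(* Let $k\geq 4$ and $n>k$ be integers. If $G$ is a $2$-connected graph on $n$ vertices with chromatic number $\chi(G)=k$ and independence number $\alpha(G)=2$, then for every integer $x\geq k$, $$P(G,x)\leq(x-1)_{k-1}\big((x-1)^{n-k+1}+(-1)^{n-k}\big),$$ with equality if and only if $G\cong G_{k+1,k}$ or $G\cong G_{k+2,k}$.
   Context: All graphs are finite and simple. $P(G,x)$ denotes the chromatic polynomial of $G$, i.e., for a positive integer $x$ the number of proper colorings $c:V(G)\to\{1,\dots,x\}$. $(x)_m=x(x-1)\cdots(x-m+1)$ denotes the falling factorial. $\alpha(G)$ is the independence number. For $m\ge k$, $G_{m,k}$ is the graph on $m$ vertices obtained from a $k$-clique by adding a path with $m-k$ new internal vertices (each of degree $2$) whose endpoints are two distinct vertices of the clique. *)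

theory Defs
  imports Complex_Main "HOL-Library.FuncSet" "Graph_Theory.Graph_Theory"
begin

text \<open>
  Finite simple graphs are represented by \<^locale>\<open>pair_graph\<close>: finite, loop-free
  digraphs whose arc relation is symmetric, an edge \<open>uv\<close> being the two arcs
  \<open>(u, v)\<close> and \<open>(v, u)\<close>.
\<close>

definition falling_fact :: "'a::comm_ring_1 \<Rightarrow> nat \<Rightarrow> 'a" where
  "falling_fact x m = (\<Prod>i<m. x - of_nat i)"

definition proper_colorings :: "'a pair_pre_digraph \<Rightarrow> nat \<Rightarrow> ('a \<Rightarrow> nat) set" where
  "proper_colorings G x =
     {c \<in> pverts G \<rightarrow>\<^sub>E {1..x}. \<forall>(u, v) \<in> parcs G. c u \<noteq> c v}"

text \<open>The chromatic polynomial, given by its values at the natural numbers.\<close>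

definition chromatic_poly :: "'a pair_pre_digraph \<Rightarrow> nat \<Rightarrow> nat" where
  "chromatic_poly G x = card (proper_colorings G x)"

definition chromatic_number :: "'a pair_pre_digraph \<Rightarrow> nat" where
  "chromatic_number G = (LEAST q. proper_colorings G q \<noteq> {})"

definition independent_set :: "'a pair_pre_digraph \<Rightarrow> 'a set \<Rightarrow> bool" where
  "independent_set G S \<longleftrightarrow> S \<subseteq> pverts G \<and> (\<forall>u\<in>S. \<forall>v\<in>S. (u, v) \<notin> parcs G)"

definition independence_number :: "'a pair_pre_digraph \<Rightarrow> nat" where
  "independence_number G = Max (card ` {S. independent_set G S})"

definition two_connected :: "'a pair_pre_digraph \<Rightarrow> bool" where
  "two_connected G \<longleftrightarrow>
     card (pverts G) > 2 \<and> Digraph_Component.connected (with_proj G) \<and>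
     (\<forall>v \<in> pverts G. Digraph_Component.connected (pre_digraph.del_vert (with_proj G) v))"

definition path_arcs :: "'a list \<Rightarrow> 'a rel" where
  "path_arcs p = set (zip p (tl p)) \<union> (set (zip p (tl p)))\<inverse>"

text \<open>
  The graph \<open>G\<^bsub>m,k\<^esub>\<close> on the vertices \<open>0, \<dots>, m - 1\<close>, meaningful for
  \<open>2 \<le> k \<le> m\<close>: the clique is \<open>{0, \<dots>, k - 1}\<close>, and the added path
  \<open>0, k, k + 1, \<dots>, m - 1, 1\<close> joins the clique vertices 0 and 1.
\<close>

definition clique_path_graph :: "nat \<Rightarrow> nat \<Rightarrow> nat pair_pre_digraph" where
  "clique_path_graph m k =
     \<lparr> pverts = {..<m},
       parcs = {(u, v). u < k \<and> v < k \<and> u \<noteq> v} \<union> path_arcs (0 # [k..<m] @ [1]) \<rparr>"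

lemma path_arcs_subset: "path_arcs p \<subseteq> set p \<times> set p"
  by (cases p) (auto simp: path_arcs_def dest: set_zip_leftD set_zip_rightD)

lemma path_arcs_irrefl: "distinct p \<Longrightarrow> (u, u) \<notin> path_arcs p"
  by (auto simp: path_arcs_def set_zip nth_tl nth_eq_iff_index_eq)

lemma pair_graph_clique_path_graph:
  assumes "2 \<le> k" "k \<le> m"
  shows "pair_graph (clique_path_graph m k)"
proof -
  let ?p = "0 # [k..<m] @ [1]"
  have d: "distinct ?p" and s: "set ?p \<subseteq> {..<m}" using assms by auto
  have sub: "parcs (clique_path_graph m k) \<subseteq> {..<m} \<times> {..<m}"
    using path_arcs_subset[of ?p] s assms unfolding clique_path_graph_def by fastforce
  have fin: "finite (parcs (clique_path_graph m k))"
    by (rule finite_subset[OF sub]) simp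
  show ?thesis
  proof
    show "e \<in> parcs (clique_path_graph m k) \<Longrightarrow> fst e \<in> pverts (clique_path_graph m k)" for e
      using sub by (auto simp: clique_path_graph_def)
    show "e \<in> parcs (clique_path_graph m k) \<Longrightarrow> snd e \<in> pverts (clique_path_graph m k)" for e
      using sub by (auto simp: clique_path_graph_def)
    show "finite (pverts (clique_path_graph m k))" by (simp add: clique_path_graph_def)
    show "finite (parcs (clique_path_graph m k))" by (fact fin)
    show "e \<in> parcs (clique_path_graph m k) \<Longrightarrow> fst e \<noteq> snd e" for e
      using path_arcs_irrefl[OF d] by (cases e) (auto simp: clique_path_graph_def)
    show "symmetric (with_proj (clique_path_graph m k))"
      by (auto simp: symmetric_def clique_path_graph_def path_arcs_def intro!: symI)
  qed
qed

end

theory Submission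
  imports Defs
begin

text \<open>
  Let \<open>t = n - k\<close>. Since \<open>\<alpha> = 2\<close>, the complement \<open>H\<close> is triangle-free, and a color class is a vertex
  or an edge of \<open>H\<close>. Removing the color class of a vertex \<open>v\<close> of \<open>H\<close>-degree \<open>d\<close> yields by
  induction, with falling factorials \<open>(x)\<^sub>m\<close>,
  \<open>P(G,x) \<le> (x)\<^sub>k ((x-1)\<^sub>t + d (x-1)\<^sub>t\<^sub>-\<^sub>1)\<close>. Some \<open>v\<close> has \<open>d \<le> t\<close>, for otherwise \<open>H\<close> has a
  matching with \<open>t + 1\<close> edges and \<open>G\<close> fewer than \<open>k\<close> color classes; hence
  \<open>P(G,x) \<le> (x)\<^sub>k (x)\<^sub>t\<close>.

  The bound to be proved is \<open>(x)\<^sub>k q\<^sub>t\<close> with \<open>q\<^sub>0 = 1\<close>, \<open>q\<^sub>t = (x-1)\<^sup>t - q\<^sub>t\<^sub>-\<^sub>1\<close>, and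
  \<open>q\<^sub>t > (x-1)\<^sup>t\<^sup>-\<^sup>1 (x-2)\<close> for \<open>t \<ge> 2\<close>. For \<open>t \<ge> 4\<close> this exceeds \<open>(x)\<^sub>t\<close>. For \<open>t = 3\<close> a
  vertex with \<open>d \<le> 2\<close> suffices, and if all \<open>H\<close>-degrees are at least 3, then \<open>H\<close> is a complete
  bipartite graph and \<open>G\<close> is disconnected. For \<open>t \<le> 2\<close> either the same arguments apply or \<open>G\<close>
  contains a \<open>k\<close>-clique, and one counts the extensions of its colorings to the one or two
  remaining vertices.
\<close>

section \<open>Colorings of graphs without independent triples\<close>

definition proper_on :: "'a rel \<Rightarrow> 'a set \<Rightarrow> ('a \<Rightarrow> 'b) \<Rightarrow> bool" where
  "proper_on E V c \<longleftrightarrow> (\<forall>u\<in>V. \<forall>v\<in>V. (u, v) \<in> E \<longrightarrow> c u \<noteq> c v)"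

definition colorings :: "'a rel \<Rightarrow> 'a set \<Rightarrow> 'b set \<Rightarrow> ('a \<Rightarrow> 'b) set" where
  "colorings E V C = {c \<in> V \<rightarrow>\<^sub>E C. proper_on E V c}"

text \<open>Chromatic number at least \<open>k\<close>. Only this lower bound is demanded, because
  it is what survives, with \<open>k - 1\<close>, the removal of an independent set; counting the
  image of \<open>c\<close> fixes no palette.\<close>

definition needs_colors :: "'a rel \<Rightarrow> 'a set \<Rightarrow> nat \<Rightarrow> bool" where
  "needs_colors E V k \<longleftrightarrow> (\<forall>c :: 'a \<Rightarrow> nat. proper_on E V c \<longrightarrow> k \<le> card (c ` V))"

definition no_indep_triple :: "'a rel \<Rightarrow> 'a set \<Rightarrow> bool" where
  "no_indep_triple E V \<longleftrightarrow>
     (\<forall>u\<in>V. \<forall>v\<in>V. \<forall>w\<in>V. u \<noteq> v \<and> v \<noteq> w \<and> u \<noteq> w \<longrightarrow> (u, v) \<in> E \<or> (v, w) \<in> E \<or> (u, w) \<in> E)"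

text \<open>The neighbourhood of \<open>v\<close> in the complement \<open>H\<close>; its size is
  the codegree of \<open>v\<close>.\<close>

definition conbrs :: "'a rel \<Rightarrow> 'a set \<Rightarrow> 'a \<Rightarrow> 'a set" where
  "conbrs E V v = {u \<in> V. u \<noteq> v \<and> (v, u) \<notin> E}"

definition clique_on :: "'a rel \<Rightarrow> 'a set \<Rightarrow> bool" where
  "clique_on E K \<longleftrightarrow> (\<forall>u\<in>K. \<forall>v\<in>K. u \<noteq> v \<longrightarrow> (u, v) \<in> E)"

text \<open>For \<open>x < k\<close> the factor with \<open>i = x\<close> vanishes, so truncated subtraction does no harm.\<close>

definition ffact_nat :: "nat \<Rightarrow> nat \<Rightarrow> nat" where
  "ffact_nat x k = (\<Prod>i<k. x - i)"

lemma ffact_nat_0 [simp]: "ffact_nat x 0 = 1"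
  by (simp add: ffact_nat_def)

lemma ffact_nat_Suc: "ffact_nat x (Suc k) = ffact_nat x k * (x - k)"
  by (simp add: ffact_nat_def)

lemma ffact_nat_Suc_left: "ffact_nat x (Suc k) = x * ffact_nat (x - 1) k"
  unfolding ffact_nat_def by (subst prod.lessThan_Suc_shift) simp

lemma ffact_nat_pos: "k \<le> x \<Longrightarrow> 0 < ffact_nat x k"
  by (auto simp: ffact_nat_def intro!: prod_pos)

lemma int_ffact_nat: "int (ffact_nat x k) = falling_fact (int x) k"
proof (cases "k \<le> x")
  case True
  then show ?thesis
    by (auto simp: ffact_nat_def falling_fact_def of_nat_diff intro!: prod.cong)
next
  case False
  then have "ffact_nat x k = 0" "falling_fact (int x) k = 0"
    by (auto simp: ffact_nat_def falling_fact_def intro!: bexI[of _ x])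
  then show ?thesis by simp
qed

lemma no_indep_triple_mono: "no_indep_triple E V \<Longrightarrow> W \<subseteq> V \<Longrightarrow> no_indep_triple E W"
  unfolding no_indep_triple_def by blast

lemma finite_colorings: "finite V \<Longrightarrow> finite C \<Longrightarrow> finite (colorings E V C)"
  unfolding colorings_def by (rule finite_subset[OF _ finite_PiE[of V "\<lambda>_. C"]]) auto

text \<open>The relation lives on the whole type and the vertex set is a separate argument, so
  deleting vertices shrinks \<open>V\<close> and leaves \<open>E\<close> alone.\<close>

locale adjacency =
  fixes E :: "'a rel"
  assumes sym: "sym E" and irrefl: "irrefl E"
begin

lemma adj_sym: "(u, v) \<in> E \<longleftrightarrow> (v, u) \<in> E"
  using sym by (meson symD)

lemma not_adj_self [simp]: "(u, u) \<notin> E"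
  using irrefl by (meson irrefl_def)

lemma proper_on_inj: "inj_on c V \<Longrightarrow> proper_on E V c"
  by (metis inj_onD not_adj_self proper_on_def)

lemma conbrs_sym: "u \<in> V \<Longrightarrow> v \<in> V \<Longrightarrow> u \<in> conbrs E V v \<longleftrightarrow> v \<in> conbrs E V u"
  by (auto simp: conbrs_def adj_sym)

lemma co_triangle_free:
  assumes "no_indep_triple E V" "u \<in> conbrs E V v" "w \<in> conbrs E V u" "v \<in> V"
  shows "w \<notin> conbrs E V v"
  using assms adj_sym unfolding no_indep_triple_def conbrs_def by blast

section \<open>Color classes and the number of colors\<close>

lemma proper_on_extend:
  fixes c :: "'a \<Rightarrow> nat"
  assumes "finite V" "S \<subseteq> V" "\<forall>u\<in>S. \<forall>v\<in>S. (u, v) \<notin> E" "proper_on E (V - S) c"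
  shows "\<exists>d :: 'a \<Rightarrow> nat. proper_on E V d \<and> card (d ` V) \<le> Suc (card (c ` (V - S)))"
proof -
  obtain j where j: "j \<notin> c ` (V - S)"
    using assms(1) ex_new_if_finite[of "c ` (V - S)"] infinite_UNIV_nat by auto
  define d where "d u = (if u \<in> S then j else c u)" for u
  have "proper_on E V d"
    using assms(3,4) j unfolding proper_on_def d_def by auto
  moreover have "d ` V \<subseteq> insert j (c ` (V - S))"
    by (auto simp: d_def)
  then have "card (d ` V) \<le> Suc (card (c ` (V - S)))"
    using card_mono[of "insert j (c ` (V - S))" "d ` V"] assms(1) j by simp
  ultimately show ?thesis by blast
qed

text \<open>A coloring of \<open>V - S\<close> with fewer than \<open>k - 1\<close> colors would
  give one of \<open>V\<close> with fewer than \<open>k\<close>, by spending a fresh color on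
  \<open>S\<close>.\<close>

lemma needs_colors_remove:
  assumes "finite V" "S \<subseteq> V" "\<forall>u\<in>S. \<forall>v\<in>S. (u, v) \<notin> E" "needs_colors E V k"
  shows "needs_colors E (V - S) (k - 1)"
  unfolding needs_colors_def
proof (intro allI impI)
  fix c :: "'a \<Rightarrow> nat" assume "proper_on E (V - S) c"
  then obtain d :: "'a \<Rightarrow> nat" where "proper_on E V d" "card (d ` V) \<le> Suc (card (c ` (V - S)))"
    using proper_on_extend[OF assms(1,2,3)] by blast
  then show "k - 1 \<le> card (c ` (V - S))"
    using assms(4) unfolding needs_colors_def by fastforce
qed

text \<open>Three vertices of one color would be an independent triple, so every class has at most
  two elements. For the whole graph this yields \<open>t \<le> k\<close>.\<close>

lemma card_le_twice_colors:
  fixes c :: "'a \<Rightarrow> 'b"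
  assumes "finite V" "no_indep_triple E V" "proper_on E V c"
  shows "card V \<le> 2 * card (c ` V)"
proof -
  have fib: "card {u \<in> V. c u = j} \<le> 2" for j
  proof (rule ccontr)
    assume "\<not> ?thesis"
    then have "3 \<le> card {u \<in> V. c u = j}" by simp
    then obtain S where S: "S \<subseteq> {u \<in> V. c u = j}" "card S = 3"
      by (meson obtain_subset_with_card_n)
    then obtain a b d where abd: "S = {a, b, d}" "a \<noteq> b" "b \<noteq> d" "a \<noteq> d"
      by (auto simp: card_3_iff)
    then have "a \<in> V" "b \<in> V" "d \<in> V" "c a = c b" "c b = c d" using S by auto
    then show False
      using abd assms(2,3) unfolding no_indep_triple_def proper_on_def by metis
  qed
  have "V = (\<Union>j\<in>c ` V. {u \<in> V. c u = j})" by auto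
  then have "card V \<le> (\<Sum>j\<in>c ` V. card {u \<in> V. c u = j})"
    using card_UN_le[of "c ` V" "\<lambda>j. {u \<in> V. c u = j}"] assms(1) by auto
  also have "\<dots> \<le> (\<Sum>j\<in>c ` V. 2)" by (intro sum_mono fib)
  finally show ?thesis by simp
qed

text \<open>Each color class is a vertex or a non-adjacent pair, so the class of a fixed vertex \<open>v\<close>
  is \<open>{v}\<close> or \<open>{v, u}\<close> with \<open>u\<close> not adjacent to \<open>v\<close>.\<close>

lemma card_colorings_remove_class:
  assumes fin: "finite V" "finite C" and v: "v \<in> V" and tr: "no_indep_triple E V"
  shows "card (colorings E V C) \<le>
    (\<Sum>j\<in>C. card (colorings E (V - {v}) (C - {j}))
      + (\<Sum>u\<in>conbrs E V v. card (colorings E (V - {u, v}) (C - {j}))))"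
proof -
  let ?N = "conbrs E V v"
  \<comment> \<open>\<open>?X S j\<close> consists of the functions that equal \<open>j\<close> on
    \<open>S\<close> and color the rest with the other colors.\<close>
  let ?ext = "\<lambda>S j c u. if u \<in> S then j else c u"
  let ?X = "\<lambda>S j. ?ext S j ` colorings E (V - S) (C - {j})"
  have finN: "finite ?N" using fin by (simp add: conbrs_def)
  have sub: "colorings E V C \<subseteq> (\<Union>j\<in>C. ?X {v} j \<union> (\<Union>u\<in>?N. ?X {u, v} j))"
  proof
    fix c assume c: "c \<in> colorings E V C"
    define S where "S = {u \<in> V. c u = c v}"
    have Sv: "v \<in> S" "S \<subseteq> V" using v by (auto simp: S_def)
    have indep: "(a, b) \<notin> E" if "a \<in> S" "b \<in> S" for a b
      using that c by (auto simp: S_def colorings_def proper_on_def) metis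
    \<comment> \<open>Colorings are extensional on their domain, so the restriction has to be
      \<open>undefined\<close> on \<open>S\<close>.\<close>
    have mem: "(\<lambda>u. if u \<in> V - S then c u else undefined) \<in> colorings E (V - S) (C - {c v})"
      using c by (auto simp: colorings_def proper_on_def S_def PiE_iff extensional_def)
    have "c = ?ext S (c v) (\<lambda>u. if u \<in> V - S then c u else undefined)"
      using c by (auto simp: colorings_def S_def PiE_iff extensional_def)
    then have mem: "c \<in> ?X S (c v)" using mem by (rule image_eqI)
    have cv: "c v \<in> C" using c v by (auto simp: colorings_def)
    have "S = {v} \<or> (\<exists>u\<in>?N. S = {u, v})"
    proof (cases "S = {v}")
      case False
      then obtain u where u: "u \<in> S" "u \<noteq> v" using Sv by auto
      then have "u \<in> ?N" using indep Sv by (auto simp: conbrs_def)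
      moreover have "S = {u, v}"
      proof (rule ccontr)
        assume "S \<noteq> {u, v}"
        then obtain w where "w \<in> S" "w \<noteq> u" "w \<noteq> v" using u Sv by auto
        with u Sv indep tr show False unfolding no_indep_triple_def by blast
      qed
      ultimately show ?thesis by blast
    qed simp
    with mem cv show "c \<in> (\<Union>j\<in>C. ?X {v} j \<union> (\<Union>u\<in>?N. ?X {u, v} j))" by blast
  qed
  have finX: "finite (?X S j)" for S j
    using fin by (intro finite_imageI finite_colorings) auto
  have cardX: "card (?X S j) \<le> card (colorings E (V - S) (C - {j}))" for S j
    using fin by (intro card_image_le finite_colorings) auto
  have "card (colorings E V C) \<le> card (\<Union>j\<in>C. ?X {v} j \<union> (\<Union>u\<in>?N. ?X {u, v} j))"
    by (intro card_mono[OF _ sub] finite_UN_I finite_UnI finX fin finN)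
  also have "\<dots> \<le> (\<Sum>j\<in>C. card (?X {v} j \<union> (\<Union>u\<in>?N. ?X {u, v} j)))"
    by (rule card_UN_le[OF fin(2)])
  also have "\<dots> \<le> (\<Sum>j\<in>C. card (?X {v} j) + (\<Sum>u\<in>?N. card (?X {u, v} j)))"
    by (intro sum_mono order_trans[OF card_Un_le] add_left_mono card_UN_le finN)
  also have "\<dots> \<le> (\<Sum>j\<in>C. card (colorings E (V - {v}) (C - {j}))
      + (\<Sum>u\<in>?N. card (colorings E (V - {u, v}) (C - {j}))))"
    by (intro sum_mono add_mono cardX)
  finally show ?thesis .
qed

section \<open>Vertices of small codegree\<close>

text \<open>\<open>H\<close> is triangle-free, so \<open>w\<close> is joined in \<open>H\<close> to
  at most one end of the edge \<open>uv\<close>.\<close>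

lemma codegree_remove_pair:
  assumes "no_indep_triple E V" "v \<in> V" "u \<in> conbrs E V v" "w \<in> V - {u, v}"
  shows "card (conbrs E V w) - 1 \<le> card (conbrs E (V - {u, v}) w)"
proof -
  have "u \<notin> conbrs E V w \<or> v \<notin> conbrs E V w"
    using co_triangle_free[OF assms(1), of v u w] assms conbrs_sym[of u V v] conbrs_sym[of v V w]
    by (auto simp: conbrs_def adj_sym)
  moreover have "conbrs E (V - {u, v}) w = conbrs E V w - {u, v}" by (auto simp: conbrs_def)
  ultimately have "conbrs E (V - {u, v}) w = conbrs E V w - {u}
      \<or> conbrs E (V - {u, v}) w = conbrs E V w - {v}"
    by blast
  then show ?thesis
    by (elim disjE) (simp_all add: card_Diff_singleton_if)
qed

text \<open>Greedy matching: deleting the ends of an edge of \<open>H\<close> lowers the minimum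
  degree by at most one, so \<open>m\<close> rounds succeed and give \<open>m\<close> disjoint edges
  of \<open>H\<close>. Each serves as one color class and saves a color.\<close>

lemma coloring_of_min_codegree:
  assumes "finite V" "V \<noteq> {}" "no_indep_triple E V" "\<forall>v\<in>V. m \<le> card (conbrs E V v)"
  shows "\<exists>c :: 'a \<Rightarrow> nat. proper_on E V c \<and> card (c ` V) + m \<le> card V"
  using assms
proof (induction m arbitrary: V)
  case 0
  obtain c :: "'a \<Rightarrow> nat" where "inj_on c V"
    using finite_imp_inj_to_nat_seg[OF 0(1)] by blast
  then have "proper_on E V c" by (rule proper_on_inj)
  then show ?case using card_image_le[OF 0(1)] by auto
next
  case (Suc m)
  obtain v where v: "v \<in> V" using Suc.prems by auto
  then have "conbrs E V v \<noteq> {}" using Suc.prems by fastforce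
  then obtain u where u: "u \<in> conbrs E V v" by auto
  let ?W = "V - {u, v}"
  have uv: "u \<in> V" "u \<noteq> v" "(v, u) \<notin> E" "(u, v) \<notin> E"
    using u adj_sym by (auto simp: conbrs_def)
  have tr: "no_indep_triple E ?W" using Suc.prems(3) by (rule no_indep_triple_mono) auto
  have deg: "m \<le> card (conbrs E ?W w)" if "w \<in> ?W" for w
    using codegree_remove_pair[OF Suc.prems(3) v u that] Suc.prems(4) that by fastforce
  have card: "card V = card ?W + 2"
    using card_Diff_subset[of "{u, v}" V] card_mono[of V "{u, v}"] uv v Suc.prems(1) by simp
  have "\<exists>c :: 'a \<Rightarrow> nat. proper_on E ?W c \<and> card (c ` ?W) + m \<le> card ?W"
  \<comment> \<open>The induction hypothesis requires a nonempty set; if nothing is left beside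
    \<open>u\<close> and \<open>v\<close>, then \<open>v\<close> has codegree at most 1, which
    forces \<open>m = 0\<close>.\<close>
  proof (cases "?W = {}")
    case True
    have "conbrs E V v \<subseteq> {u}" using True by (auto simp: conbrs_def)
    then have "card (conbrs E V v) \<le> 1"
      using card_mono[of "{u}"] by fastforce
    then have "m = 0" using Suc.prems(4) v by fastforce
    then show ?thesis unfolding True by (simp add: proper_on_def)
  next
    case False
    then show ?thesis using Suc.IH[of ?W] Suc.prems(1) tr deg by blast
  qed
  then obtain c :: "'a \<Rightarrow> nat" where c: "proper_on E ?W c" "card (c ` ?W) + m \<le> card ?W" by blast
  have "\<exists>d :: 'a \<Rightarrow> nat. proper_on E V d \<and> card (d ` V) \<le> Suc (card (c ` ?W))"
    by (rule proper_on_extend) (use Suc.prems(1) uv v c in auto)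
  then show ?case using c(2) card by fastforce
qed

text \<open>Minimum codegree \<open>t + 1\<close> would give a coloring with at most
  \<open>k - 1\<close> colors.\<close>

lemma exists_small_codegree:
  assumes "finite V" "V \<noteq> {}" "no_indep_triple E V" "needs_colors E V k" "card V = k + t"
  shows "\<exists>v\<in>V. card (conbrs E V v) \<le> t"
proof (rule ccontr)
  assume "\<not> ?thesis"
  then have "\<forall>v\<in>V. Suc t \<le> card (conbrs E V v)" by auto
  then obtain c :: "'a \<Rightarrow> nat" where "proper_on E V c" "card (c ` V) + Suc t \<le> card V"
    using coloring_of_min_codegree[OF assms(1,2,3)] by blast
  then show False using assms(4,5) unfolding needs_colors_def by fastforce
qed

section \<open>The bound by a product of two falling factorials\<close>

text \<open>The recursion step, kept apart from the induction because it serves twice: inside it for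
  a vertex of codegree at most \<open>t\<close>, and afterwards, with the bound known, for any
  vertex. The color of the class of \<open>v\<close> can be chosen in \<open>x\<close> ways, and
  \<open>x\<close> times \<open>(x-1)_{k-1}\<close> is \<open>(x)_k\<close>.\<close>

lemma card_colorings_le_via_vertex_aux:
  fixes C :: "'b set"
  assumes fin: "finite V" "finite C" and tr: "no_indep_triple E V" and need: "needs_colors E V k"
    and card: "card V = k + t" and tk: "t \<le> k" and v: "v \<in> V"
    and t: "t = 0 \<Longrightarrow> conbrs E V v = {}"
    and bound: "\<And>W (D :: 'b set) k' t'. W \<subset> V \<Longrightarrow> finite D \<Longrightarrow> needs_colors E W k' \<Longrightarrow>
      card W = k' + t' \<Longrightarrow> t' \<le> k' \<Longrightarrow>
      card (colorings E W D) \<le> ffact_nat (card D) k' * ffact_nat (card D) t'"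
  shows "card (colorings E V C) \<le> ffact_nat (card C) k *
    (ffact_nat (card C - 1) t + card (conbrs E V v) * ffact_nat (card C - 1) (t - 1))"
proof -
  let ?x = "card C" and ?N = "conbrs E V v"
  let ?a = "ffact_nat (?x - 1) (k - 1) * ffact_nat (?x - 1) t"
  let ?b = "ffact_nat (?x - 1) (k - 1) * ffact_nat (?x - 1) (t - 1)"
  have "card V > 0" using v fin card_gt_0_iff by blast
  then have k: "1 \<le> k" using card tk by linarith
  have a: "card (colorings E (V - {v}) (C - {j})) \<le> ?a" if j: "j \<in> C" for j
  proof (cases "t < k")
    case True
    have "needs_colors E (V - {v}) (k - 1)"
      by (rule needs_colors_remove) (use fin v need in auto)
    moreover have "card (V - {v}) = (k - 1) + t" using card v k by simp
    moreover have "V - {v} \<subset> V" "t \<le> k - 1" using v True by auto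
    ultimately show ?thesis
      using bound[of "V - {v}" "C - {j}" "k - 1" t] fin j by auto
  next
    case False
    \<comment> \<open>For \<open>k = t\<close> the pair \<open>(k - 1, t)\<close> violates
      \<open>t' \<le> k'\<close>. The \<open>2 * t - 1\<close> remaining vertices still need
      \<open>t\<close> colors, as classes have at most two vertices, so \<open>bound\<close> is
      applied to \<open>(t, t - 1)\<close>; the product is the same.\<close>
    then have kt: "k = t" using tk by simp
    have card': "card (V - {v}) = t + (t - 1)" using card v k kt by simp
    have "needs_colors E (V - {v}) t"
      unfolding needs_colors_def
    proof (intro allI impI)
      fix c :: "'a \<Rightarrow> nat" assume "proper_on E (V - {v}) c"
      then have "card (V - {v}) \<le> 2 * card (c ` (V - {v}))"
        using fin no_indep_triple_mono[OF tr, of "V - {v}"] by (intro card_le_twice_colors) auto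
      then show "t \<le> card (c ` (V - {v}))" using card' k kt by linarith
    qed
    then have "card (colorings E (V - {v}) (C - {j}))
        \<le> ffact_nat (card (C - {j})) t * ffact_nat (card (C - {j})) (t - 1)"
      by (intro bound) (use v fin card' in auto)
    then show ?thesis using j kt by (simp add: mult.commute)
  qed
  have b: "card (colorings E (V - {u, v}) (C - {j})) \<le> ?b" if u: "u \<in> ?N" and j: "j \<in> C" for u j
  proof -
    have uv: "u \<in> V" "u \<noteq> v" "(v, u) \<notin> E" "(u, v) \<notin> E"
      using u adj_sym by (auto simp: conbrs_def)
    have t1: "1 \<le> t" using t u by (cases t) auto
    have "needs_colors E (V - {u, v}) (k - 1)"
      by (rule needs_colors_remove) (use fin v uv need in auto)
    moreover have "card (V - {u, v}) = (k - 1) + (t - 1)"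
      using card_Diff_subset[of "{u, v}" V] uv v card k t1 by simp
    moreover have "V - {u, v} \<subset> V" using v by auto
    ultimately show ?thesis
      using bound[of "V - {u, v}" "C - {j}" "k - 1" "t - 1"] v fin j tk by auto
  qed
  have "card (colorings E V C) \<le>
    (\<Sum>j\<in>C. card (colorings E (V - {v}) (C - {j}))
      + (\<Sum>u\<in>?N. card (colorings E (V - {u, v}) (C - {j}))))"
    by (rule card_colorings_remove_class) (use fin v tr in auto)
  also have "\<dots> \<le> (\<Sum>j\<in>C. ?a + (\<Sum>u\<in>?N. ?b))"
    by (intro sum_mono add_mono a b)
  also have "\<dots> = (?x * ffact_nat (?x - 1) (k - 1)) *
      (ffact_nat (?x - 1) t + card ?N * ffact_nat (?x - 1) (t - 1))"
    by (simp add: algebra_simps)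
  also have "?x * ffact_nat (?x - 1) (k - 1) = ffact_nat ?x k"
    using ffact_nat_Suc_left[of ?x "k - 1"] k by simp
  finally show ?thesis .
qed

text \<open>The bound is attained by the disjoint union of a \<open>k\<close>-clique and a \<open>t\<close>-clique.\<close>

lemma card_colorings_le:
  fixes C :: "'b set"
  assumes "finite V" "finite C" "no_indep_triple E V" "needs_colors E V k"
    "card V = k + t" "t \<le> k"
  shows "card (colorings E V C) \<le> ffact_nat (card C) k * ffact_nat (card C) t"
  using assms
proof (induction "card V" arbitrary: V C k t rule: less_induct)
  case less
  let ?x = "card C"
  show ?case
  proof (cases "V = {}")
    case True
    then have "colorings E V C \<subseteq> {\<lambda>_. undefined}" by (auto simp: colorings_def)
    then have "card (colorings E V C) \<le> card {\<lambda>_ :: 'a. undefined :: 'b}"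
      by (intro card_mono) auto
    then show ?thesis using less.prems True by simp
  next
    case False
    obtain v where v: "v \<in> V" "card (conbrs E V v) \<le> t"
      using exists_small_codegree[of V k t] less.prems False by auto
    have "finite (conbrs E V v)" using less.prems(1) by (simp add: conbrs_def)
    then have "t = 0 \<Longrightarrow> conbrs E V v = {}" using v(2) by simp
    moreover have "card (colorings E W D) \<le> ffact_nat (card D) k' * ffact_nat (card D) t'"
      if "W \<subset> V" "finite D" "needs_colors E W k'" "card W = k' + t'" "t' \<le> k'"
      for W and D :: "'b set" and k' t'
      using that less.prems(1,3) psubset_card_mono[OF less.prems(1) that(1)]
      by (intro less.hyps) (auto intro: finite_subset no_indep_triple_mono)
    ultimately have "card (colorings E V C) \<le> ffact_nat ?x k *
        (ffact_nat (?x - 1) t + card (conbrs E V v) * ffact_nat (?x - 1) (t - 1))"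
      using less.prems v(1) by (intro card_colorings_le_via_vertex_aux) auto
    also have "\<dots> \<le> ffact_nat ?x k * (ffact_nat (?x - 1) t + t * ffact_nat (?x - 1) (t - 1))"
      using v(2) by (intro mult_left_mono add_left_mono mult_right_mono) auto
    also have "\<dots> = ffact_nat ?x k * ffact_nat ?x t"
    proof (cases t)
      case (Suc s)
      have "k \<noteq> 0" using Suc less.prems(6) by simp
      then have "ffact_nat 0 k = 0" by (cases k) (simp_all add: ffact_nat_Suc_left)
      \<comment> \<open>\<open>(x)_t = (x-1)_t + t (x-1)_{t-1}\<close> counts injections of
        \<open>t\<close> points by whether they hit a fixed color. Under truncated subtraction it
        fails for \<open>x = 0\<close>, \<open>t = 1\<close>; there the factor \<open>(x)_k\<close>
        vanishes.\<close>
      moreover have "ffact_nat (?x - 1) (Suc s) + Suc s * ffact_nat (?x - 1) s = ffact_nat ?x (Suc s)"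
        if "?x > 0"
      proof (cases "s < ?x")
        case True
        then have "?x = ?x - 1 - s + Suc s" by simp
        then have "ffact_nat ?x (Suc s) = (?x - 1 - s + Suc s) * ffact_nat (?x - 1) s"
          by (metis ffact_nat_Suc_left)
        then show ?thesis 
          by (simp only: ffact_nat_Suc[of "?x - 1"] distrib_right distrib_left mult.commute)
      next
        case False
        then have "ffact_nat (?x - 1) s = 0" "ffact_nat (?x - 1) (Suc s) = 0"
          using that by (auto simp: ffact_nat_def intro!: bexI[of _ "?x - 1"])
        then show ?thesis by (simp add: ffact_nat_Suc_left)
      qed
      ultimately show ?thesis using Suc by (cases "?x = 0") auto
    qed simp
    finally show ?thesis .
  qed
qed

text \<open>Once \<open>card_colorings_le\<close> covers all proper subsets, any vertex can start
  the recursion, so a vertex of codegree below \<open>t\<close> sharpens the bound.\<close>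

lemma card_colorings_le_via_vertex:
  assumes "finite V" "finite C" "no_indep_triple E V" "needs_colors E V k"
    "card V = k + t" "t \<le> k" "1 \<le> t" "v \<in> V" "card (conbrs E V v) \<le> d"
  shows "card (colorings E V C) \<le> ffact_nat (card C) k *
    (ffact_nat (card C - 1) t + d * ffact_nat (card C - 1) (t - 1))"
proof -
  have "card (colorings E V C) \<le> ffact_nat (card C) k *
      (ffact_nat (card C - 1) t + card (conbrs E V v) * ffact_nat (card C - 1) (t - 1))"
    using assms
    by (intro card_colorings_le_via_vertex_aux)
      (auto intro!: card_colorings_le intro: finite_subset no_indep_triple_mono)
  also have "\<dots> \<le> ffact_nat (card C) k * (ffact_nat (card C - 1) t + d * ffact_nat (card C - 1) (t - 1))"
    using assms by (intro mult_left_mono add_left_mono mult_right_mono) auto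
  finally show ?thesis .
qed

section \<open>Matchings, cliques and joins in the complement\<close>

text \<open>Here \<open>f\<close> is a matching of \<open>H\<close> from \<open>X\<close> into
  \<open>V - X\<close>. Giving \<open>f y\<close> the color of \<open>y\<close> saves
  \<open>card X\<close> colors.\<close>

lemma needs_colors_no_comatching:
  assumes "finite V" "needs_colors E V k" "X \<subseteq> V" "inj_on f X" "f ` X \<subseteq> V - X"
    "\<And>x. x \<in> X \<Longrightarrow> (x, f x) \<notin> E"
  shows "k + card X \<le> card V"
proof -
  obtain g :: "'a \<Rightarrow> nat" where g: "inj_on g V"
    using finite_imp_inj_to_nat_seg[OF assms(1)] by blast
  \<comment> \<open>\<open>h\<close> sends every matched vertex \<open>f y\<close> back to
    \<open>y\<close>; it identifies only the ends of matching edges, so its composition with an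
    injective \<open>g\<close> is proper.\<close>
  define h where "h u = (if u \<in> f ` X then the_inv_into X f u else u)" for u
  have hf: "h (f y) = y" if "y \<in> X" for y
    using that assms(4) by (simp add: h_def the_inv_into_f_f)
  have hX: "h u \<in> X" if "u \<in> f ` X" for u using that hf by auto
  have hV: "h ` V \<subseteq> V - f ` X"
  proof
    fix z assume "z \<in> h ` V"
    then obtain u where u: "u \<in> V" "z = h u" by auto
    show "z \<in> V - f ` X"
    proof (cases "u \<in> f ` X")
      case True then show ?thesis using hX[of u] u assms(3,5) by auto
    next
      case False then show ?thesis using u by (simp add: h_def)
    qed
  qed
  have "proper_on E V (g \<circ> h)"
    unfolding proper_on_def
  proof (intro ballI impI notI)
    fix u v assume uv: "u \<in> V" "v \<in> V" "(u, v) \<in> E" "(g \<circ> h) u = (g \<circ> h) v"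
    then have eq: "h u = h v" using g hV by (auto dest: inj_onD)
    have ne: "u \<noteq> v" using uv(3) by auto
    have fh: "f (h u) = u" if "u \<in> f ` X" for u using that hf by auto
    show False
    proof (cases "u \<in> f ` X")
      case True
      show False
      proof (cases "v \<in> f ` X")
        case True then show False using \<open>u \<in> f ` X\<close> eq ne fh by metis
      next
        case False
        then have "h v = v" by (simp add: h_def)
        then have "v \<in> X" "f v = u" using hX[OF True] fh[OF True] eq by auto
        then show False using assms(6) uv(3) adj_sym by auto
      qed
    next
      case False
      then have hu: "h u = u" by (simp add: h_def)
      show False
      proof (cases "v \<in> f ` X")
        case True
        then have "u \<in> X" "f u = v" using hX[OF True] fh[OF True] eq hu by auto
        then show False using assms(6) uv(3) by auto
      next
        case False then show False using hu eq ne by (simp add: h_def)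
      qed
    qed
  qed
  then have "k \<le> card ((g \<circ> h) ` V)" using assms(2) unfolding needs_colors_def by blast
  also have "\<dots> \<le> card (h ` V)" using assms(1) by (metis card_image_le finite_imageI image_comp)
  also have "\<dots> \<le> card (V - f ` X)" using hV assms(1) by (intro card_mono) auto
  also have "\<dots> = card V - card X"
    using assms by (metis Diff_subset card_Diff_subset card_image finite_subset subset_trans)
  finally show ?thesis using card_mono[OF assms(1,3)] by linarith
qed

text \<open>Two disjoint edges of \<open>H\<close> would save two colors, for which
  \<open>k + 1\<close> vertices leave no room.\<close>

lemma needs_colors_no_two_coedges:
  assumes "finite V" "needs_colors E V k" "card V < k + 2" "{a, b, c, d} \<subseteq> V" "distinct [a, b, c, d]"
    "(a, b) \<notin> E"
  shows "(c, d) \<in> E"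
proof (rule ccontr)
  assume "(c, d) \<notin> E"
  then have "k + card {a, c} \<le> card V"
    using assms by (intro needs_colors_no_comatching[where f = "\<lambda>y. if y = a then b else d"]) auto
  then show False using assms by auto
qed

text \<open>By \<open>needs_colors_no_two_coedges\<close> any two edges of \<open>H\<close> meet, so
  they form a star or a triangle. Independent triples being excluded, \<open>z\<close> is the centre
  of a star.\<close>

lemma ex_clique_minus_vertex:
  assumes "finite V" "no_indep_triple E V" "needs_colors E V k" "card V = k + 1"
  shows "\<exists>z\<in>V. clique_on E (V - {z})"
proof -
  have "V \<noteq> {}" using assms(4) by auto
  have two: "(c, d) \<in> E"
    if "a \<in> V" "b \<in> V" "c \<in> V" "d \<in> V" "distinct [a, b, c, d]" "(a, b) \<notin> E" for a b c d
    using needs_colors_no_two_coedges[of V k a b c d] assms that by auto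
  show ?thesis
  proof (rule ccontr)
    assume neg: "\<not> ?thesis"
    then have ex: "\<exists>a\<in>V. \<exists>b\<in>V. a \<noteq> z \<and> b \<noteq> z \<and> a \<noteq> b \<and> (a, b) \<notin> E" if "z \<in> V" for z
      using that unfolding clique_on_def by blast
    obtain a b where ab: "a \<in> V" "b \<in> V" "a \<noteq> b" "(a, b) \<notin> E" using ex \<open>V \<noteq> {}\<close> by blast
    obtain c d where cd: "c \<in> V" "d \<in> V" "c \<noteq> a" "d \<noteq> a" "c \<noteq> d" "(c, d) \<notin> E"
      using ex[OF ab(1)] by blast
    then have "c = b \<or> d = b" using two[of a b c d] ab by auto
    then obtain e where e: "e \<in> V" "e \<noteq> a" "e \<noteq> b" "(b, e) \<notin> E" using cd adj_sym by metis
    \<comment> \<open>An edge of \<open>H\<close> avoiding \<open>b\<close> has to meet both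
      \<open>ab\<close> and \<open>be\<close>, so it is \<open>ae\<close> and closes a
      triangle.\<close>
    obtain p q where pq: "p \<in> V" "q \<in> V" "p \<noteq> b" "q \<noteq> b" "p \<noteq> q" "(p, q) \<notin> E"
      using ex[OF ab(2)] by blast
    have "p = a \<or> q = a" "p = e \<or> q = e" using two[of a b p q] two[of b e p q] ab e pq by auto
    then have "(a, e) \<notin> E" using pq adj_sym e(2) by metis
    then show False
      using assms(2) ab e unfolding no_indep_triple_def by metis
  qed
qed

text \<open>Without the ends of the edge \<open>vw\<close> of \<open>H\<close>, there remain
  \<open>k\<close> vertices needing \<open>k - 1\<close> colors, and all but one of them,
  \<open>z\<close>, form a clique. The vertex \<open>v\<close> misses only \<open>w\<close>, so it
  completes this clique to \<open>k\<close> vertices.\<close>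

lemma ex_clique_of_codegree_one:
  assumes "finite V" "no_indep_triple E V" "needs_colors E V k" "card V = k + 2" "1 \<le> k"
    "v \<in> V" "card (conbrs E V v) = 1"
  shows "\<exists>K\<subseteq>V. clique_on E K \<and> card K = k"
proof -
  obtain w where w: "conbrs E V v = {w}" using assms(7) card_1_singletonE by blast
  then have wV: "w \<in> V" "w \<noteq> v" "(v, w) \<notin> E" "(w, v) \<notin> E"
    using adj_sym by (auto simp: conbrs_def)
  let ?W = "V - {v, w}"
  have cardW: "card ?W = (k - 1) + 1"
    using card_Diff_subset[of "{v, w}" V] assms wV by simp
  have "needs_colors E ?W (k - 1)"
    by (rule needs_colors_remove) (use assms wV in auto)
  then obtain z where z: "z \<in> ?W" "clique_on E (?W - {z})"
    using ex_clique_minus_vertex[of ?W "k - 1"] cardW assms(1) no_indep_triple_mono[OF assms(2)]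
    by (metis Diff_subset finite_Diff)
  have v: "(v, u) \<in> E" "(u, v) \<in> E" if "u \<in> V" "u \<noteq> v" "u \<noteq> w" for u
    using w that adj_sym unfolding conbrs_def by blast+
  have "clique_on E (V - {w, z})"
    unfolding clique_on_def
  proof (intro ballI impI)
    fix a b assume "a \<in> V - {w, z}" "b \<in> V - {w, z}" "a \<noteq> b"
    then show "(a, b) \<in> E"
      using v z(2) unfolding clique_on_def by (cases "a = v"; cases "b = v") auto
  qed
  moreover have "card (V - {w, z}) = k"
    using card_Diff_subset[of "{w, z}" V] assms wV z(1) by auto
  ultimately show ?thesis by blast
qed

text \<open>The condition \<open>2 * t + 2 \<le> card V\<close> excludes the 5-cycle.\<close>

lemma cojoin_of_min_codegree:
  assumes "finite V" "no_indep_triple E V" "needs_colors E V k" "card V = k + t"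
    "\<forall>v\<in>V. t \<le> card (conbrs E V v)" "2 * t + 2 \<le> card V"
  shows "\<exists>A\<subseteq>V. card A = t \<and> (\<forall>a\<in>A. \<forall>b\<in>V - A. (a, b) \<notin> E)"
  using assms
proof (induction t arbitrary: V k)
  case 0
  then show ?case by auto
next
  case (Suc t)
  note fin = Suc.prems(1) and tr = Suc.prems(2) and need = Suc.prems(3)
    and cardV = Suc.prems(4) and deg = Suc.prems(5) and big = Suc.prems(6)
  have "V \<noteq> {}" using cardV by auto
  then obtain v where v: "v \<in> V" by auto
  then have "conbrs E V v \<noteq> {}" using deg by fastforce
  then obtain u where u: "u \<in> conbrs E V v" by auto
  then have uV: "u \<in> V" "u \<noteq> v" "(v, u) \<notin> E" "(u, v) \<notin> E"
    using adj_sym by (auto simp: conbrs_def)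
  \<comment> \<open>The ends of an edge of \<open>H\<close> are deleted; degrees drop by at most
    one, and the inductive set \<open>A\<close> will be enlarged by one of the two ends.\<close>
  let ?W = "V - {u, v}"
  have cardW: "card ?W + 2 = card V"
    using card_Diff_subset[of "{u, v}" V] uV v big by simp
  have "t \<le> card (conbrs E ?W w)" if "w \<in> ?W" for w
    using codegree_remove_pair[OF tr v u that] deg that by fastforce
  moreover have "needs_colors E ?W (k - 1)"
    by (rule needs_colors_remove) (use fin need uV v in auto)
  ultimately have "\<exists>A\<subseteq>?W. card A = t \<and> (\<forall>a\<in>A. \<forall>b\<in>?W - A. (a, b) \<notin> E)"
    using fin no_indep_triple_mono[OF tr, of ?W] cardW cardV big
    by (intro Suc.IH[of ?W "k - 1"]) auto
  then obtain A where A: "A \<subseteq> ?W" "card A = t" "\<And>a b. a \<in> A \<Longrightarrow> b \<in> ?W - A \<Longrightarrow> (a, b) \<notin> E"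
    by blast
  define B where "B = ?W - A"
  have finA: "finite A" using A(1) fin by (meson finite_Diff finite_subset)
  have cardB: "t + 2 \<le> card B"
    using card_Diff_subset[OF finA A(1)] A(2) cardW big by (simp add: B_def)
  have AB: "(a, b) \<notin> E" "(b, a) \<notin> E" if "a \<in> A" "b \<in> B" for a b
    using A(3) that adj_sym by (auto simp: B_def)
  have BV: "b \<in> V" "b \<noteq> u" "b \<noteq> v" "b \<notin> A" if "b \<in> B" for b using that by (auto simp: B_def)
  have AV: "a \<in> V" "a \<noteq> u" "a \<noteq> v" "a \<notin> B" if "a \<in> A" for a using that A(1) by (auto simp: B_def)
  \<comment> \<open>If \<open>A\<close> is nonempty, two vertices of \<open>B\<close> joined in
    \<open>H\<close> would form a triangle with a vertex of \<open>A\<close>. If \<open>A\<close> is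
    empty, then \<open>card V = k + 1\<close> and the edge \<open>uv\<close> excludes a second one
    disjoint from it.\<close>
  have B_clique: "(b, b') \<in> E" if b: "b \<in> B" "b' \<in> B" "b \<noteq> b'" for b b'
  proof (cases "A = {}")
    case True
    then have "t = 0" using A(2) by simp
    then show ?thesis
      using needs_colors_no_two_coedges[of V k u v b b'] fin need cardV uV v b BV by auto
  next
    case False
    then obtain a where a: "a \<in> A" by auto
    then have "a \<noteq> b" "a \<noteq> b'" using b AV by blast+
    then show ?thesis
      using tr AV(1)[OF a] BV(1)[OF b(1)] BV(1)[OF b(2)] b AB(1)[OF a b(1)] AB(1)[OF a b(2)]
      unfolding no_indep_triple_def by metis
  qed
  \<comment> \<open>The neighbours of \<open>b\<close> in \<open>H\<close> lie in \<open>A\<close>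
    together with \<open>u\<close> and \<open>v\<close>, and \<open>A\<close> alone has one too
    few.\<close>
  have B_uv: "(b, u) \<notin> E \<or> (b, v) \<notin> E" if b: "b \<in> B" for b
  proof (rule ccontr)
    assume neg: "\<not> ?thesis"
    have "conbrs E V b \<subseteq> A"
    proof
      fix y assume y: "y \<in> conbrs E V b"
      then have "y \<notin> B" "y \<noteq> u" "y \<noteq> v" using B_clique[of b y] b neg by (auto simp: conbrs_def)
      then show "y \<in> A" using y by (auto simp: conbrs_def B_def)
    qed
    then have "card (conbrs E V b) \<le> t" using card_mono[OF finA] A(2) by auto
    then show False using deg BV(1)[OF b] by fastforce
  qed
  \<comment> \<open>Otherwise \<open>u b1\<close>, \<open>v b0\<close> and a matching of
    \<open>A\<close> into the rest of \<open>B\<close> are \<open>t + 2\<close> disjoint edges of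
    \<open>H\<close>, one more than the need for \<open>k\<close> colors permits. The room for
    \<open>A\<close> comes from \<open>t + 2 \<le> card B\<close>.\<close>
  have one_side: "(\<forall>b\<in>B. (b, u) \<notin> E) \<or> (\<forall>b\<in>B. (b, v) \<notin> E)"
  proof (rule ccontr)
    assume "\<not> ?thesis"
    then obtain b0 b1 where b01: "b0 \<in> B" "b1 \<in> B" "(b0, u) \<in> E" "(b1, v) \<in> E" by blast
    then have b: "(b0, v) \<notin> E" "(b1, u) \<notin> E" "b0 \<noteq> b1" using B_uv by auto
    have "card A \<le> card (B - {b0, b1})"
      using card_Diff_subset[of "{b0, b1}" B] b01 b(3) cardB A(2) by simp
    then obtain h where h: "h ` A \<subseteq> B - {b0, b1}" "inj_on h A"
      using card_le_inj[OF finA] fin by (metis B_def finite_Diff)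
    define f where "f y = (if y = u then b1 else if y = v then b0 else h y)" for y
    have fA: "f a = h a" if "a \<in> A" for a using AV[OF that] by (simp add: f_def)
    have fuv: "f u = b1" "f v = b0" using uV by (auto simp: f_def)
    let ?X = "insert u (insert v A)"
    have "f ` ?X \<subseteq> B" using h(1) fA fuv b01 by auto
    moreover have "inj_on f ?X"
    proof -
      have "inj_on f A" using h(2) fA by (simp add: inj_on_def)
      moreover have "f u \<notin> f ` A" "f v \<notin> f ` A" "f u \<noteq> f v" using h(1) fA fuv b(3) by auto
      ultimately show ?thesis by (auto simp: inj_on_insert)
    qed
    moreover have "B \<subseteq> V - ?X" using BV by blast
    moreover have "?X \<subseteq> V" using AV(1) uV(1) v by blast
    moreover have "(y, f y) \<notin> E" if "y \<in> ?X" for y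
    proof -
      consider "y = u" | "y = v" | "y \<in> A" using \<open>y \<in> ?X\<close> by auto
      then show ?thesis
      proof cases
        case 3
        then have "f y \<in> B" using h(1) fA by auto
        then show ?thesis using AB(1) 3 by blast
      qed (use fuv b adj_sym in metis)+
    qed
    ultimately have "k + card ?X \<le> card V"
      using fin need by (intro needs_colors_no_comatching[of V k ?X f]) blast+
    moreover have "card ?X = t + 2" using A(2) finA uV(2) AV(2,3) by (auto simp: card_insert_if)
    ultimately show False using cardV by simp
  qed
  \<comment> \<open>The end \<open>p\<close> is joined in \<open>H\<close> to all of
    \<open>B\<close>, so triangle-freeness keeps \<open>q\<close> away from \<open>B\<close>; by its
    degree \<open>q\<close> is joined to all of \<open>insert p A\<close>, which is the new
    set.\<close>
  have finish: "\<exists>A\<subseteq>V. card A = Suc t \<and> (\<forall>a\<in>A. \<forall>b\<in>V - A. (a, b) \<notin> E)"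
    if pq: "{p, q} = {u, v}" "p \<noteq> q" "\<forall>b\<in>B. (b, p) \<notin> E" for p q
  proof -
    have pqV: "p \<in> V" "q \<in> V" "(p, q) \<notin> E" "p \<notin> A" "q \<notin> A" "p \<notin> B" "q \<notin> B"
      using pq(1,2) uV v A(1) by (auto simp: doubleton_eq_iff B_def)
    have VB: "V = insert q B \<union> insert p A" using pq(1) uV v A(1) by (auto simp: B_def)
    have "conbrs E V q \<subseteq> insert p A"
    proof
      fix y assume y: "y \<in> conbrs E V q"
      have "y \<notin> B"
      proof
        assume "y \<in> B"
        then have "(y, p) \<notin> E" "y \<in> V" "y \<noteq> p" "y \<noteq> q" "(y, q) \<notin> E"
          using pq(3) BV pqV y adj_sym by (auto simp: conbrs_def)
        then show False
          using tr pqV(1,2,3) pq(2) unfolding no_indep_triple_def by metis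
      qed
      then show "y \<in> insert p A" using y VB by (auto simp: conbrs_def)
    qed
    moreover have "card (insert p A) = Suc t" using finA A(2) pqV by simp
    moreover have "Suc t \<le> card (conbrs E V q)" using deg pqV by blast
    ultimately have "conbrs E V q = insert p A" using finA by (intro card_seteq) auto
    then have q: "(a, q) \<notin> E" if "a \<in> insert p A" for a
      using that adj_sym by (auto simp: conbrs_def)
    have "(a, b) \<notin> E" if "a \<in> insert p A" "b \<in> V - insert p A" for a b
      using that VB q[of a] AB(1)[of a b] pq(3) adj_sym by auto
    moreover have "insert p A \<subseteq> V" using VB by auto
    ultimately show ?thesis using \<open>card (insert p A) = Suc t\<close> by blast
  qed
  show ?case
    using one_side finish[of u v] finish[of v u] uV(2) by (auto simp: insert_commute)
qed

text \<open>Handshake lemma for \<open>H\<close>: a new vertex \<open>z\<close> adds its degree once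
  for itself and once over its neighbours.\<close>

lemma even_sum_codegree:
  assumes "finite V"
  shows "even (\<Sum>v\<in>V. card (conbrs E V v))"
  using assms
proof (induction V rule: finite_induct)
  case (insert z F)
  have *: "card (conbrs E (insert z F) v) = card (conbrs E F v) + (if v \<in> conbrs E F z then 1 else 0)"
    if "v \<in> F" for v
  proof (cases "(v, z) \<in> E")
    case True
    then have "conbrs E (insert z F) v = conbrs E F v" by (auto simp: conbrs_def)
    then show ?thesis using True adj_sym by (auto simp: conbrs_def)
  next
    case False
    then have "conbrs E (insert z F) v = insert z (conbrs E F v)" "z \<notin> conbrs E F v"
      "v \<in> conbrs E F z"
      using that insert.hyps(2) adj_sym by (auto simp: conbrs_def)
    then show ?thesis using insert.hyps(1) by (simp add: conbrs_def)
  qed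
  have z: "conbrs E (insert z F) z = conbrs E F z" by (auto simp: conbrs_def)
  have "(\<Sum>v\<in>F. if v \<in> conbrs E F z then 1 else (0::nat)) = card (F \<inter> conbrs E F z)"
    using insert.hyps(1) by (simp add: sum.If_cases)
  also have "F \<inter> conbrs E F z = conbrs E F z" by (auto simp: conbrs_def)
  finally show ?case
    using insert * z by (simp add: sum.distrib)
qed simp

text \<open>Covers \<open>k = 4\<close>, \<open>t = 3\<close>, where
  \<open>2 * t + 2 \<le> card V\<close> just fails. By parity \<open>H\<close> is not 3-regular; a
  vertex of codegree at least 4 has a neighbourhood \<open>B\<close> independent in
  \<open>H\<close>, and each vertex of \<open>B\<close> must be joined to all of
  \<open>V - B\<close>, which has at most three vertices.\<close>

lemma cojoin_of_seven_vertices: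
  assumes "finite V" "no_indep_triple E V" "card V = 7" "\<forall>v\<in>V. 3 \<le> card (conbrs E V v)"
  shows "\<exists>A\<subseteq>V. card A = 3 \<and> (\<forall>a\<in>A. \<forall>b\<in>V - A. (a, b) \<notin> E)"
proof -
  have "\<exists>w\<in>V. card (conbrs E V w) \<noteq> 3"
  proof (rule ccontr)
    assume "\<not> ?thesis"
    then have "(\<Sum>v\<in>V. card (conbrs E V v)) = 21" using assms(3) by simp
    then show False using even_sum_codegree[OF assms(1)] by simp
  qed
  then obtain w where w: "w \<in> V" "4 \<le> card (conbrs E V w)" using assms(4) by force
  define B where "B = conbrs E V w"
  have BV: "B \<subseteq> V" by (auto simp: B_def conbrs_def)
  have finA: "finite (V - B)" using assms(1) by simp
  have cardA: "card (V - B) \<le> 3"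
    using card_Diff_subset[of B V] BV finite_subset[OF BV assms(1)] w(2) assms(3) by (simp add: B_def)
  have *: "conbrs E V b = V - B \<and> card (V - B) = 3" if b: "b \<in> B" for b
  proof -
    have "conbrs E V b \<subseteq> V - B"
      using co_triangle_free[OF assms(2), of b w] b w(1) by (auto simp: B_def conbrs_def)
    moreover have "3 \<le> card (conbrs E V b)" using assms(4) b BV by blast
    ultimately show ?thesis
      using cardA card_mono[OF finA] card_seteq[OF finA] by (metis le_antisym le_trans)
  qed
  have "B \<noteq> {}" using w(2) by (auto simp: B_def)
  then have "card (V - B) = 3" using * by blast
  moreover have "(a, b) \<notin> E" if "a \<in> V - B" "b \<in> V - (V - B)" for a b
    using that *[of b] adj_sym by (auto simp: conbrs_def)
  ultimately show ?thesis by blast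
qed

section \<open>Counting extensions of colorings\<close>

lemma colorings_insert:
  assumes "v \<notin> V"
  shows "colorings E (insert v V) C =
    (\<lambda>(c, j). c(v := j)) ` (SIGMA c:colorings E V C. C - c ` {u \<in> V. (v, u) \<in> E})" (is "_ = ?R")
proof
  show "colorings E (insert v V) C \<subseteq> ?R"
  proof
    fix c assume c: "c \<in> colorings E (insert v V) C"
    let ?d = "c(v := undefined)"
    have "?d \<in> colorings E V C"
      using c assms by (auto simp: colorings_def proper_on_def PiE_iff extensional_def)
    moreover have "c v \<in> C - ?d ` {u \<in> V. (v, u) \<in> E}"
      using c assms by (auto simp: colorings_def proper_on_def)
    moreover have "c = ?d(v := c v)" by simp
    ultimately show "c \<in> ?R" by (intro image_eqI[of _ _ "(?d, c v)"]) auto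
  qed
  show "?R \<subseteq> colorings E (insert v V) C"
  proof clarify
    fix c j assume c: "c \<in> colorings E V C" and j: "j \<in> C" "j \<notin> c ` {u \<in> V. (v, u) \<in> E}"
    have "proper_on E (insert v V) (c(v := j))"
      unfolding proper_on_def
    proof (intro ballI impI)
      fix a b assume "a \<in> insert v V" "b \<in> insert v V" "(a, b) \<in> E"
      then show "(c(v := j)) a \<noteq> (c(v := j)) b"
        using c j assms adj_sym[of a b] by (auto simp: colorings_def proper_on_def)
    qed
    then show "c(v := j) \<in> colorings E (insert v V) C"
      using c j(1) by (auto simp: colorings_def PiE_iff extensional_def)
  qed
qed

lemma card_colorings_insert:
  assumes "finite V" "finite C" "v \<notin> V"
  shows "card (colorings E (insert v V) C) =
    (\<Sum>c\<in>colorings E V C. card C - card (c ` {u \<in> V. (v, u) \<in> E}))"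
proof -
  let ?N = "{u \<in> V. (v, u) \<in> E}"
  have "inj_on (\<lambda>(c, j). c(v := j)) (SIGMA c:colorings E V C. C - c ` ?N)"
  proof (rule inj_onI, clarify)
    fix c j d i assume c: "c \<in> colorings E V C" "d \<in> colorings E V C" and eq: "c(v := j) = d(v := i)"
    have "c y = d y" for y
      using c assms(3) fun_cong[OF eq, of y] by (cases "y = v") (auto simp: colorings_def PiE_iff extensional_def)
    then show "c = d \<and> j = i" using fun_cong[OF eq, of v] by auto
  qed
  then have "card (colorings E (insert v V) C) = card (SIGMA c:colorings E V C. C - c ` ?N)"
    by (simp add: colorings_insert[OF assms(3)] card_image)
  also have "\<dots> = (\<Sum>c\<in>colorings E V C. card (C - c ` ?N))"
    using assms by (intro card_SigmaI) (auto simp: finite_colorings)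
  also have "\<dots> = (\<Sum>c\<in>colorings E V C. card C - card (c ` ?N))"
    using assms by (intro sum.cong refl card_Diff_subset) (auto simp: colorings_def)
  finally show ?thesis .
qed

lemma inj_on_coloring_clique:
  "c \<in> colorings E V C \<Longrightarrow> S \<subseteq> V \<Longrightarrow> clique_on E S \<Longrightarrow> inj_on c S"
  unfolding colorings_def proper_on_def clique_on_def inj_on_def by blast

text \<open>The clique \<open>S\<close> carries \<open>card S\<close> different colors, all
  forbidden at \<open>v\<close>.\<close>

lemma card_colorings_insert_le:
  assumes "finite V" "finite C" "v \<notin> V" "S \<subseteq> V" "clique_on E S" "\<forall>u\<in>S. (v, u) \<in> E"
  shows "card (colorings E (insert v V) C) \<le> card (colorings E V C) * (card C - card S)"
proof -
  have "card S \<le> card (c ` {u \<in> V. (v, u) \<in> E})" if "c \<in> colorings E V C" for c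
  proof -
    have "card S = card (c ` S)" using inj_on_coloring_clique[OF that assms(4,5)] by (simp add: card_image)
    also have "\<dots> \<le> card (c ` {u \<in> V. (v, u) \<in> E})" using assms by (intro card_mono) auto
    finally show ?thesis .
  qed
  then have "(\<Sum>c\<in>colorings E V C. card C - card (c ` {u \<in> V. (v, u) \<in> E}))
      \<le> (\<Sum>c\<in>colorings E V C. card C - card S)"
    by (intro sum_mono diff_le_mono2) auto
  then show ?thesis using card_colorings_insert[OF assms(1-3)] by simp
qed

text \<open>If the whole neighbourhood of \<open>v\<close> is a clique, the number of forbidden
  colors is the same for every coloring.\<close>

lemma card_colorings_insert_eq:
  assumes "finite V" "finite C" "v \<notin> V" "{u \<in> V. (v, u) \<in> E} = S" "clique_on E S"
  shows "card (colorings E (insert v V) C) = card (colorings E V C) * (card C - card S)"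
proof -
  have "card (c ` {u \<in> V. (v, u) \<in> E}) = card S" if "c \<in> colorings E V C" for c
    using inj_on_coloring_clique[OF that _ assms(5)] assms(4) by (auto simp: card_image)
  then show ?thesis using card_colorings_insert[OF assms(1-3)] by simp
qed

lemma card_colorings_clique:
  assumes "finite K" "finite C" "clique_on E K"
  shows "card (colorings E K C) = ffact_nat (card C) (card K)"
  using assms
proof (induction K rule: finite_induct)
  case empty
  have "colorings E {} C = {\<lambda>_. undefined}" by (auto simp: colorings_def proper_on_def)
  then show ?case by simp
next
  case (insert v K)
  have "{u \<in> K. (v, u) \<in> E} = K" "clique_on E K"
    using insert.prems(2) insert.hyps(2) by (auto simp: clique_on_def)
  then have "card (colorings E (insert v K) C) = card (colorings E K C) * (card C - card K)"
    using insert by (intro card_colorings_insert_eq) auto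
  then show ?case using insert \<open>clique_on E K\<close> by (simp add: ffact_nat_Suc)
qed

text \<open>Among the \<open>x - 1\<close> colors of \<open>u\<close> one is the color of \<open>b\<close>, which leaves \<open>x - 1\<close> colors
  for \<open>v\<close>, while the \<open>x - 2\<close> others leave \<open>x - 2\<close>.\<close>

lemma card_colorings_clique_ear:
  assumes fin: "finite K" "finite C" and cl: "clique_on E K" and C: "2 \<le> card C"
    and uv: "u \<notin> K" "v \<notin> K" "u \<noteq> v"
    and N: "{w \<in> K. (u, w) \<in> E} = {a}" "{w \<in> K. (v, w) \<in> E} = {b}" "a \<noteq> b" "(u, v) \<in> E"
  shows "card (colorings E (insert v (insert u K)) (C :: 'b set))
    = ffact_nat (card C) (card K) * ((card C - 1) * (card C - 2) + 1)"
proof -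
  let ?x = "card C" and ?P = "colorings E (insert u K) C"
  let ?D = "{c \<in> ?P. c u = c b}"
  have ab: "a \<in> K" "b \<in> K" using N by auto
  have P: "card ?P = ffact_nat ?x (card K) * (?x - 1)"
    using card_colorings_insert_eq[OF fin uv(1) N(1)] card_colorings_clique[OF fin cl]
    by (simp add: clique_on_def)
  have finP: "finite ?P" using fin by (simp add: finite_colorings)
  \<comment> \<open>Colorings with \<open>c u = c b\<close> correspond to colorings of
    \<open>K\<close>: the only neighbour of \<open>u\<close> in \<open>K\<close> is
    \<open>a\<close>, whose color differs from that of \<open>b\<close>.\<close>
  have "bij_betw (\<lambda>c. c(u := c b)) (colorings E K C) ?D"
  proof (rule bij_betwI[where g = "\<lambda>c. c(u := undefined)"])
    show "(\<lambda>c. c(u := c b)) \<in> colorings E K C \<rightarrow> ?D"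
    proof
      fix c assume c: "c \<in> colorings E K C"
      have "c b \<noteq> c a"
        using inj_on_coloring_clique[OF c subset_refl cl] ab N(3) by (metis inj_onD)
      then have "c(u := c b) \<in> ?P"
        using c ab unfolding colorings_insert[OF uv(1)] N(1)
        by (intro image_eqI[of _ _ "(c, c b)"]) (auto simp: colorings_def)
      then show "c(u := c b) \<in> ?D" using ab uv by auto
    qed
    show "(\<lambda>c. c(u := undefined)) \<in> ?D \<rightarrow> colorings E K C"
      using uv by (auto simp: colorings_def proper_on_def PiE_iff extensional_def)
    show "(c(u := c b))(u := undefined) = c" if "c \<in> colorings E K C" for c
    proof -
      have "c u = undefined" using that uv(1) by (auto simp: colorings_def PiE_iff extensional_def)
      then show ?thesis by (simp add: fun_upd_idem)
    qed
    show "(c(u := undefined))(u := (c(u := undefined)) b) = c" if "c \<in> ?D" for c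
    proof -
      have "u \<noteq> b" "c u = c b" using that uv ab by auto
      then show ?thesis by (metis fun_upd_apply fun_upd_triv fun_upd_upd)
    qed
  qed
  then have D: "card ?D = ffact_nat ?x (card K)"
    using bij_betw_same_card[of _ "colorings E K C" ?D] card_colorings_clique[OF fin cl] by simp
  have Nv: "{w \<in> insert u K. (v, w) \<in> E} = {u, b}" using N uv adj_sym by auto
  have "?x - card (c ` {u, b}) = (?x - 2) + (if c u = c b then 1 else 0)" for c :: "'a \<Rightarrow> 'b"
    using C by (simp add: card_insert_if numeral_2_eq_2)
  then have "card (colorings E (insert v (insert u K)) C)
      = (\<Sum>c\<in>?P. (?x - 2) + (if c u = c b then 1 else 0))"
    using card_colorings_insert[of "insert u K" C v] fin uv Nv by simp
  also have "\<dots> = card ?P * (?x - 2) + card ?D"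
    using finP by (simp only: sum.distrib sum_constant sum.inter_filter[symmetric]) simp
  finally show ?thesis by (simp only: P D distrib_left mult.assoc mult_1_right)
qed

end

section \<open>The bound for two-connected adjacency relations\<close>

text \<open>The number of ways to color the \<open>t\<close> internal vertices of a path whose end vertices have
  been given two distinct colors out of \<open>x\<close>: the last vertex must avoid the color of its end.\<close>

fun ear_colorings :: "int \<Rightarrow> nat \<Rightarrow> int" where
  "ear_colorings x 0 = 1"
| "ear_colorings x (Suc t) = (x - 1) ^ Suc t - ear_colorings x t"

section \<open>Estimates for the ear count\<close>

text \<open>Multiplied by \<open>x - 1\<close>, this is the chromatic polynomial of the cycle on
  \<open>t + 2\<close> vertices: the ear and the edge between its ends form such a cycle, and
  \<open>x * (x - 1)\<close> counts the colorings of that edge.\<close>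

lemma mult_ear_colorings: "x * ear_colorings x t = (x - 1) ^ (t + 1) + (- 1) ^ t"
  by (induction t) (simp_all add: algebra_simps)

text \<open>Two steps of the recursion remove the alternating sign, which makes positivity and a
  lower bound visible.\<close>

lemma ear_colorings_Suc_Suc:
  "ear_colorings x (Suc (Suc t)) = (x - 1) ^ Suc t * (x - 2) + ear_colorings x t"
  by (simp add: algebra_simps)

lemma ear_colorings_pos: "3 \<le> x \<Longrightarrow> 0 < ear_colorings x t"
proof (induction t rule: less_induct)
  case (less t)
  consider "t = 0" | "t = 1" | s where "t = Suc (Suc s)"
    by (metis One_nat_def not0_implies_Suc)
  then show ?case
  proof cases
    case 3
    have "0 < (x - 1) ^ Suc s * (x - 2)" using less.prems by simp
    moreover have "0 < ear_colorings x s" using less 3 by simp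
    ultimately show ?thesis unfolding 3 ear_colorings_Suc_Suc by linarith
  qed (use less.prems in simp_all)
qed

lemma ear_colorings_2:
  assumes "2 \<le> x"
  shows "ear_colorings (int x) 2 = int ((x - 1) * (x - 2) + 1)"
proof -
  have "ear_colorings (int x) 2 = (int x - 1) * (int x - 2) + 1"
    by (simp add: numeral_2_eq_2 algebra_simps)
  then show ?thesis using assms by (simp add: of_nat_diff)
qed

text \<open>The factor \<open>x\<close> of \<open>mult_ear_colorings\<close> completes
  \<open>(x-1)_{k-1}\<close> to \<open>(x)_k\<close>.\<close>

lemma bound_eq_ear_colorings:
  assumes "1 \<le> k" "k \<le> x"
  shows "falling_fact (int x - 1) (k - 1) * ((int x - 1) ^ (t + 1) + (- 1) ^ t)
    = int (ffact_nat x k) * ear_colorings (int x) t"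
proof -
  have "ffact_nat x k = x * ffact_nat (x - 1) (k - 1)"
    using ffact_nat_Suc_left[of x "k - 1"] assms by simp
  then have "int (ffact_nat x k) = int x * falling_fact (int x - 1) (k - 1)"
    using assms by (simp add: int_ffact_nat of_nat_diff)
  then show ?thesis by (simp only: mult_ear_colorings[symmetric] mult_ac)
qed

text \<open>At \<open>t = 4\<close> it reduces to \<open>x * (x - 3) \<le> (x - 1)^2\<close>, and
  each further factor \<open>x - t\<close> is at most \<open>x - 1\<close>. For \<open>t = 3\<close>
  and \<open>x \<ge> 3\<close> it is false, so that case has to go through a vertex of small
  codegree.\<close>

lemma ffact_nat_le_power:
  assumes "4 \<le> t" "t \<le> x"
  shows "ffact_nat x t \<le> (x - 1) ^ (t - 1) * (x - 2)"
  using assms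
proof (induction t rule: dec_induct)
  case base
  then obtain y where y: "x = 4 + y" using le_Suc_ex by blast
  have "ffact_nat x 4 = x * (x - 1) * (x - 2) * (x - 3)"
    by (simp add: ffact_nat_def eval_nat_numeral)
  also have "\<dots> = (4 + y) * (3 + y) * (2 + y) * (1 + y)" by (simp add: y)
  also have "\<dots> = ((4 + y) * (1 + y)) * ((3 + y) * (2 + y))" by (simp only: mult_ac)
  also have "\<dots> \<le> ((3 + y) * (3 + y)) * ((3 + y) * (2 + y))"
    by (rule mult_right_mono) (simp_all add: algebra_simps)
  also have "\<dots> = (x - 1) ^ (4 - 1) * (x - 2)"
  proof -
    have "x - 1 = 3 + y" "x - 2 = 2 + y" "4 - 1 = (3::nat)" using y by auto
    then show ?thesis by (simp only: power3_eq_cube mult.assoc)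
  qed
  finally show ?case .
next
  case (step t)
  have "ffact_nat x (Suc t) = ffact_nat x t * (x - t)" by (rule ffact_nat_Suc)
  also have "\<dots> \<le> ((x - 1) ^ (t - 1) * (x - 2)) * (x - 1)"
    using step by (intro mult_mono) auto
  also have "\<dots> = (x - 1) ^ Suc (t - 1) * (x - 2)" by simp
  finally show ?case using step.hyps by simp
qed

section \<open>Cliques with an ear, and the case distinction on \<open>t\<close>\<close>

text \<open>\<open>one_ear\<close> and \<open>two_ear\<close> are \<open>G_{k+1,k}\<close> and
  \<open>G_{k+2,k}\<close> up to isomorphism, phrased by neighbourhoods in the clique to suit the
  extension counts.\<close>

definition one_ear :: "'a rel \<Rightarrow> 'a set \<Rightarrow> nat \<Rightarrow> bool" where
  "one_ear E V k \<longleftrightarrow> (\<exists>K z a b. V = insert z K \<and> z \<notin> K \<and> clique_on E K \<and> card K = k \<and>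
     a \<noteq> b \<and> {w \<in> K. (z, w) \<in> E} = {a, b})"

definition two_ear :: "'a rel \<Rightarrow> 'a set \<Rightarrow> nat \<Rightarrow> bool" where
  "two_ear E V k \<longleftrightarrow> (\<exists>K u v a b. V = insert v (insert u K) \<and> u \<notin> K \<and> v \<notin> K \<and> u \<noteq> v \<and>
     clique_on E K \<and> card K = k \<and> a \<noteq> b \<and> (u, v) \<in> E \<and>
     {w \<in> K. (u, w) \<in> E} = {a} \<and> {w \<in> K. (v, w) \<in> E} = {b})"

context adjacency
begin

lemma card_colorings_one_ear:
  assumes "finite V" "finite C" "one_ear E V k"
  shows "card (colorings E V C) = ffact_nat (card C) k * (card C - 2)"
proof -
  obtain K z a b where K: "V = insert z K" "z \<notin> K" "clique_on E K" "card K = k" "a \<noteq> b"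
      "{w \<in> K. (z, w) \<in> E} = {a, b}"
    using assms(3) unfolding one_ear_def by blast
  have "{a, b} \<subseteq> K" using K(6) by blast
  then have "clique_on E {a, b}" using K(3) by (auto simp: clique_on_def)
  moreover have finK: "finite K" using assms(1) K(1) by simp
  ultimately have "card (colorings E V C) = card (colorings E K C) * (card C - card {a, b})"
    unfolding K(1) using assms(2) K(2,6) by (intro card_colorings_insert_eq)
  then show ?thesis using card_colorings_clique[OF finK assms(2) K(3)] K(4,5)
    by (simp add: numeral_2_eq_2)
qed

lemma card_colorings_two_ear:
  assumes "finite V" "finite C" "two_ear E V k" "2 \<le> card C"
  shows "card (colorings E V C) = ffact_nat (card C) k * ((card C - 1) * (card C - 2) + 1)"
proof -
  obtain K u v a b where K: "V = insert v (insert u K)" "u \<notin> K" "v \<notin> K" "u \<noteq> v"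
      "clique_on E K" "card K = k" "a \<noteq> b" "(u, v) \<in> E"
      "{w \<in> K. (u, w) \<in> E} = {a}" "{w \<in> K. (v, w) \<in> E} = {b}"
    using assms(3) unfolding two_ear_def by blast
  then show ?thesis
    using card_colorings_clique_ear[of K C u v a b] assms by simp
qed

text \<open>By \<open>ear_colorings_Suc_Suc\<close> the quantity bounding \<open>m\<close> falls
  short of \<open>ear_colorings\<close> at \<open>t\<close> by its value at \<open>t - 2\<close>,
  which is positive.\<close>

lemma card_colorings_less:
  assumes "card (colorings E V C) \<le> ffact_nat (card C) k * m" "4 \<le> k" "k \<le> card C" "2 \<le> t"
    "m \<le> (card C - 1) ^ (t - 1) * (card C - 2)"
  shows "int (card (colorings E V C)) < int (ffact_nat (card C) k) * ear_colorings (int (card C)) t"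
proof -
  obtain s where s: "t = Suc (Suc s)" using le_Suc_ex[OF assms(4)] by auto
  have "int m \<le> int ((card C - 1) ^ (t - 1) * (card C - 2))" using assms(5) by (rule of_nat_mono)
  also have "\<dots> = (int (card C) - 1) ^ Suc s * (int (card C) - 2)"
    using assms(2,3) s by (simp add: of_nat_diff)
  also have "\<dots> < ear_colorings (int (card C)) t"
    using ear_colorings_pos[of "int (card C)" s] assms(2,3) by (simp only: s ear_colorings_Suc_Suc) simp
  finally have "int (ffact_nat (card C) k) * int m
      < int (ffact_nat (card C) k) * ear_colorings (int (card C)) t"
    using ffact_nat_pos[OF assms(3)] by simp
  moreover have "int (card (colorings E V C)) \<le> int (ffact_nat (card C) k) * int m"
    using assms(1) by (metis of_nat_le_iff of_nat_mult)
  ultimately show ?thesis by linarith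
qed

text \<open>Connectivity enters as cuts: \<open>conn\<close> gives an edge across every cut of
  \<open>V\<close>, \<open>conn2\<close> across every cut after the deletion of one vertex. Equality
  survives only for \<open>t \<le> 2\<close>, and only when all but \<open>t\<close> vertices form a
  clique.\<close>

lemma card_colorings_le_ear_colorings:
  assumes fin: "finite V" "finite C" and tr: "no_indep_triple E V" and need: "needs_colors E V k"
    and cardV: "card V = k + t" and tk: "t \<le> k" and k: "4 \<le> k" and t: "1 \<le> t" and x: "k \<le> card C"
    and conn: "\<And>A. A \<subseteq> V \<Longrightarrow> A \<noteq> {} \<Longrightarrow> V - A \<noteq> {} \<Longrightarrow> \<exists>p\<in>A. \<exists>q\<in>V - A. (p, q) \<in> E"
    and conn2: "\<And>A w. w \<in> V \<Longrightarrow> A \<subseteq> V \<Longrightarrow> A - {w} \<noteq> {} \<Longrightarrow> V - A - {w} \<noteq> {} \<Longrightarrow>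
      \<exists>p\<in>A - {w}. \<exists>q\<in>V - A - {w}. (p, q) \<in> E"
  defines "F \<equiv> int (ffact_nat (card C) k) * ear_colorings (int (card C)) t"
  shows "int (card (colorings E V C)) \<le> F \<and>
    (int (card (colorings E V C)) = F \<longrightarrow> one_ear E V k \<or> two_ear E V k)"
proof -
  let ?x = "card C" and ?P = "card (colorings E V C)"
  have strict: ?thesis if "?P \<le> ffact_nat ?x k * m" "2 \<le> t" "m \<le> (?x - 1) ^ (t - 1) * (?x - 2)" for m
    using card_colorings_less[OF that(1) k x that(2,3)] unfolding F_def by simp
  have no_cojoin: False if "A \<subseteq> V" "card A = t" "\<forall>a\<in>A. \<forall>b\<in>V - A. (a, b) \<notin> E" for A
  proof -
    have "A \<noteq> {}" using that(2) t by auto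
    moreover have "V - A \<noteq> {}" using that(1,2) cardV k by auto
    ultimately show False using conn[OF that(1)] that(3) by blast
  qed
  consider "4 \<le> t" | "t = 3" | "t = 2" | "t = 1" using t by linarith
  then show ?thesis
  proof cases
    case 1
    have "?P \<le> ffact_nat ?x k * ffact_nat ?x t"
      by (rule card_colorings_le) (use fin tr need cardV tk in auto)
    then show ?thesis using 1 ffact_nat_le_power[OF 1] tk x by (intro strict) auto
  next
    case 2
    obtain v where v: "v \<in> V" "card (conbrs E V v) \<le> 2"
    proof (rule ccontr)
      assume "\<not> thesis"
      then have deg: "\<forall>v\<in>V. 3 \<le> card (conbrs E V v)" using that by fastforce
      have "\<exists>A\<subseteq>V. card A = 3 \<and> (\<forall>a\<in>A. \<forall>b\<in>V - A. (a, b) \<notin> E)"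
      \<comment> \<open>\<open>card V = k + 3\<close> reaches \<open>2 * 3 + 2\<close> from
        \<open>k = 5\<close> on; \<open>k = 4\<close> needs the parity argument.\<close>
      proof (cases "k = 4")
        case True
        then show ?thesis using cojoin_of_seven_vertices[OF fin(1) tr _ deg] cardV 2 by simp
      next
        case False
        then show ?thesis
          using cojoin_of_min_codegree[OF fin(1) tr need, of 3] cardV 2 k deg by simp
      qed
      then show False using no_cojoin 2 by blast
    qed
    have "?P \<le> ffact_nat ?x k * (ffact_nat (?x - 1) t + 2 * ffact_nat (?x - 1) (t - 1))"
      by (rule card_colorings_le_via_vertex) (use fin tr need cardV tk t v in auto)
    \<comment> \<open>In fact an equality: with \<open>x = 3 + y\<close> both sides are
      \<open>(2 + y)^2 * (1 + y)\<close>, so codegree 2 is the most that this estimate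
      tolerates.\<close>
    moreover have "ffact_nat (?x - 1) t + 2 * ffact_nat (?x - 1) (t - 1) \<le> (?x - 1) ^ (t - 1) * (?x - 2)"
    proof -
      have "3 \<le> ?x" using x k by simp
      then obtain y where y: "?x = 3 + y" using le_Suc_ex by blast
      have "ffact_nat (?x - 1) 3 = (2 + y) * (1 + y) * y" "ffact_nat (?x - 1) 2 = (2 + y) * (1 + y)"
        by (simp_all add: y ffact_nat_def numeral_eq_Suc)
      moreover have "?x - 1 = 2 + y" "?x - 2 = 1 + y" using y by auto
      ultimately show ?thesis using 2 by (simp add: power2_eq_square algebra_simps)
    qed
    ultimately show ?thesis using 2 by (intro strict) auto
  next
    case 3
    \<comment> \<open>Codegree 0 gives the factor \<open>(x - 1) * (x - 2)\<close>, minimum codegree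
      2 a disconnected graph, and codegree 1 a \<open>k\<close>-clique.\<close>
    consider v where "v \<in> V" "card (conbrs E V v) = 0" | v where "v \<in> V" "card (conbrs E V v) = 1"
      | "\<forall>v\<in>V. 2 \<le> card (conbrs E V v)"
      by (metis One_nat_def Suc_1 less_2_cases not_less)
    then show ?thesis
    proof cases
      fix v assume v: "v \<in> V" "card (conbrs E V v) = 0"
      have "?P \<le> ffact_nat ?x k * (ffact_nat (?x - 1) t + 0 * ffact_nat (?x - 1) (t - 1))"
        by (rule card_colorings_le_via_vertex) (use fin tr need cardV tk t v in auto)
      then show ?thesis using 3 by (intro strict) (auto simp: numeral_2_eq_2 ffact_nat_Suc)
    next
      assume "\<forall>v\<in>V. 2 \<le> card (conbrs E V v)"
      then have "\<exists>A\<subseteq>V. card A = 2 \<and> (\<forall>a\<in>A. \<forall>b\<in>V - A. (a, b) \<notin> E)"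
        using cojoin_of_min_codegree[OF fin(1) tr need, of 2] cardV 3 k by simp
      then show ?thesis using no_cojoin 3 by blast
    next
      fix v assume "v \<in> V" "card (conbrs E V v) = 1"
      then obtain K where K: "K \<subseteq> V" "clique_on E K" "card K = k"
        using ex_clique_of_codegree_one[OF fin(1) tr need] cardV 3 k by auto
      have finK: "finite K" using K(1) fin(1) by (rule finite_subset)
      have "card (V - K) = 2" using K cardV 3 finK by (simp add: card_Diff_subset)
      then obtain u v where uv: "V - K = {u, v}" "u \<noteq> v" by (auto simp: card_2_iff)
      let ?N = "\<lambda>y. {w \<in> K. (y, w) \<in> E}"
      \<comment> \<open>With two neighbours in \<open>K\<close>, \<open>p\<close> has at most
        \<open>x - 2\<close> colors, and \<open>q\<close>, having some neighbour by connectedness,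
        at most \<open>x - 1\<close>; the product is one less than \<open>ear_colorings\<close> at
        2.\<close>
      have many: ?thesis if pq: "{p, q} = {u, v}" "2 \<le> card (?N p)" for p q
      proof -
        have pqV: "p \<notin> K" "q \<notin> insert p K" "V = insert q (insert p K)"
          using pq(1) uv K(1) by (auto simp: doubleton_eq_iff)
        have "card (colorings E (insert p K) C) \<le> card (colorings E K C) * (?x - card (?N p))"
          by (rule card_colorings_insert_le) (use finK fin pqV K in \<open>auto simp: clique_on_def\<close>)
        also have "\<dots> \<le> ffact_nat ?x k * (?x - 2)"
          using pq(2) card_colorings_clique[OF finK fin(2) K(2)] K(3) by (auto intro!: mult_mono)
        finally have p: "card (colorings E (insert p K) C) \<le> ffact_nat ?x k * (?x - 2)" .
        have "K \<noteq> {}" using K(3) k by auto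
        then obtain w where w: "w \<in> V - {q}" "(q, w) \<in> E"
          using conn[of "{q}"] pqV by auto
        have "?P \<le> card (colorings E (insert p K) C) * (?x - card {w})"
          unfolding pqV(3)
          by (rule card_colorings_insert_le) (use finK fin pqV w in \<open>auto simp: clique_on_def\<close>)
        also have "\<dots> \<le> (ffact_nat ?x k * (?x - 2)) * (?x - 1)"
          using p by (intro mult_mono) auto
        finally have "?P \<le> ffact_nat ?x k * ((?x - 2) * (?x - 1))" by (simp only: mult.assoc)
        then show ?thesis using 3 by (intro strict) auto
      qed
      show ?thesis
      proof (cases "2 \<le> card (?N u) \<or> 2 \<le> card (?N v)")
        case True
        then show ?thesis using many[of u v] many[of v u] by (auto simp: insert_commute)
      next
        case False
        then have few: "card (?N y) \<le> 1" if "y \<in> {u, v}" for y using that by auto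
        have uniq: "?N y = {a}" if "y \<in> {u, v}" "a \<in> K" "(y, a) \<in> E" for y a
        proof -
          have "card {a} \<le> card (?N y)" using that finK by (intro card_mono) auto
          then have "card (?N y) = 1" using few[OF that(1)] by simp
          then obtain e where "?N y = {e}" by (rule card_1_singletonE)
          moreover have "a \<in> ?N y" using that by simp
          ultimately show ?thesis by (simp only: singleton_iff)
        qed
        have VK: "V - {u, v} = K" using uv K(1) by auto
        have "K \<noteq> {}" using K(3) k by auto
        moreover have uvV: "{u, v} \<subseteq> V" using uv by blast
        \<comment> \<open>Connectedness gives one edge from \<open>{u, v}\<close> to
          \<open>K\<close>, and connectedness after deleting its end \<open>a\<close> a second one,
          ending in another vertex \<open>b\<close>. As \<open>p\<close> and \<open>q\<close> have
          only one neighbour each in \<open>K\<close>, they differ.\<close>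
        ultimately obtain p a where p: "p \<in> {u, v}" "a \<in> K" "(p, a) \<in> E"
          using conn[of "{u, v}"] unfolding VK by blast
        have "\<not> K \<subseteq> {a}" using card_mono[of "{a}" K] K(3) k by auto
        then have "V - {u, v} - {a} \<noteq> {}" using VK by auto
        moreover have "a \<noteq> u" using p(2) uv by blast
        then have "{u, v} - {a} \<noteq> {}" by blast
        ultimately obtain q b where q: "q \<in> {u, v}" "b \<in> K" "b \<noteq> a" "(q, b) \<in> E"
          using conn2[OF _ uvV, of a] p(2) K(1) unfolding VK by blast
        have Np: "?N p = {a}" and Nq: "?N q = {b}" using uniq p q by blast+
        have pq: "p \<noteq> q" using Np Nq q(3) by auto
        have "\<not> K \<subseteq> {a, b}"
          using card_mono[of "{a, b}" K] card_insert_le_m1[of 2 "{b}" a] K(3) k by auto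
        \<comment> \<open>A third vertex \<open>y\<close> of the clique is adjacent to neither
          \<open>p\<close> nor \<open>q\<close>, so \<open>{p, q, y}\<close> would be independent if
          \<open>p\<close> and \<open>q\<close> were not adjacent.\<close>
        then obtain y where y: "y \<in> K" "y \<noteq> a" "y \<noteq> b" by auto
        then have "(p, y) \<notin> E" "(q, y) \<notin> E" using Np Nq by auto
        moreover have pqV: "p \<in> V" "q \<in> V" "p \<notin> K" "q \<notin> K" using p q uv by auto
        moreover have "y \<in> V" "y \<noteq> p" "y \<noteq> q" using y K(1) pqV by auto
        ultimately have "(p, q) \<in> E"
          using tr pq unfolding no_indep_triple_def by metis
        moreover have "V = insert q (insert p K)" using uv K(1) p(1) q(1) pq by auto
        ultimately have ear: "two_ear E V k"
          unfolding two_ear_def using Np Nq pq pqV(3,4) K(2,3) q(3)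
          by (intro exI[of _ K] exI[of _ p] exI[of _ q] exI[of _ a] exI[of _ b]) simp
        then have "?P = ffact_nat ?x k * ((?x - 1) * (?x - 2) + 1)"
          by (rule card_colorings_two_ear[OF fin]) (use x k in simp)
        moreover have "ear_colorings (int ?x) t = int ((?x - 1) * (?x - 2) + 1)"
          using ear_colorings_2[of ?x] x k 3 by simp
        ultimately have "int ?P = F" unfolding F_def by (simp only: of_nat_mult)
        then show ?thesis using ear by simp
      qed
    qed
  next
    case 4
    obtain z where z: "z \<in> V" "clique_on E (V - {z})"
      using ex_clique_minus_vertex[OF fin(1) tr need] cardV 4 by auto
    let ?K = "V - {z}" and ?N = "{w \<in> V - {z}. (z, w) \<in> E}"
    have cardK: "card ?K = k" using z cardV 4 by simp
    have "?K \<noteq> {}" using cardK k by (metis card.empty not_numeral_le_zero)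
    \<comment> \<open>Two-connectedness gives \<open>z\<close> two neighbours in the clique
      \<open>?K\<close>; the count is exact, and equality means that there are no others.\<close>
    then obtain a where a: "a \<in> ?K" "(z, a) \<in> E" using conn[of "{z}"] z by auto
    have "\<not> ?K \<subseteq> {a}" using card_mono[of "{a}" ?K] cardK k by auto
    then have "V - {z} - {a} \<noteq> {}" by auto
    then obtain b where b: "b \<in> ?K" "b \<noteq> a" "(z, b) \<in> E" using conn2[of a "{z}"] z a by auto
    have finN: "finite ?N" using fin(1) by simp
    have "card {a, b} \<le> card ?N" using a b by (intro card_mono finN) auto
    then have N2: "2 \<le> card ?N" using b by simp
    have "card (colorings E (insert z ?K) C) = card (colorings E ?K C) * (?x - card ?N)"
      by (rule card_colorings_insert_eq) (use fin z in \<open>auto simp: clique_on_def\<close>)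
    moreover have "insert z ?K = V" using z(1) by auto
    ultimately have P: "?P = ffact_nat ?x k * (?x - card ?N)"
      using card_colorings_clique[of ?K C] fin z(2) cardK by auto
    have F: "F = int (ffact_nat ?x k * (?x - 2))"
      using 4 x k by (simp add: F_def of_nat_diff)
    show ?thesis
    proof (cases "card ?N = 2")
      case True
      then obtain a b where "a \<noteq> b" "?N = {a, b}" by (auto simp: card_2_iff)
      moreover have "z \<notin> ?K" by simp
      ultimately have "one_ear E V k"
        unfolding one_ear_def using z(2) cardK \<open>insert z ?K = V\<close>[symmetric]
        by (intro exI[of _ ?K] exI[of _ z] exI[of _ a] exI[of _ b] conjI)
      then show ?thesis using P True F by simp
    next
      case False
      then have "?x - card ?N < ?x - 2" using N2 x k by simp
      then have "?P < ffact_nat ?x k * (?x - 2)" using P ffact_nat_pos[OF x] by simp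
      then show ?thesis unfolding F by linarith
    qed
  qed
qed

end

section \<open>Pair graphs and isomorphisms\<close>

lemma card_colorings_bij:
  assumes f: "bij_betw f V W"
    and adj: "\<And>u v. u \<in> V \<Longrightarrow> v \<in> V \<Longrightarrow> (u, v) \<in> E \<longleftrightarrow> (f u, f v) \<in> F"
  shows "card (colorings E V C) = card (colorings F W C)"
proof -
  let ?g = "the_inv_into V f"
  have g: "?g (f u) = u" if "u \<in> V" for u
    using that f by (simp add: bij_betw_def the_inv_into_f_f)
  have fg: "f (?g w) = w" "?g w \<in> V" if "w \<in> W" for w
    using that f by (auto simp: bij_betw_def f_the_inv_into_f intro: the_inv_into_into)
  have fW: "f u \<in> W" if "u \<in> V" for u using that f by (auto simp: bij_betw_def)
  have "bij_betw (\<lambda>c. restrict (c \<circ> f) V) (colorings F W C) (colorings E V C)"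
  proof (rule bij_betwI[where g = "\<lambda>c. restrict (c \<circ> ?g) W"])
    show "(\<lambda>c. restrict (c \<circ> f) V) \<in> colorings F W C \<rightarrow> colorings E V C"
      using fW adj by (auto simp: colorings_def proper_on_def)
    show "(\<lambda>c. restrict (c \<circ> ?g) W) \<in> colorings E V C \<rightarrow> colorings F W C"
      using fg adj by (auto simp: colorings_def proper_on_def)
    show "restrict (restrict (c \<circ> f) V \<circ> ?g) W = c" if "c \<in> colorings F W C" for c
      using that fg by (auto simp: colorings_def fun_eq_iff PiE_iff extensional_def)
    show "restrict (restrict (c \<circ> ?g) W \<circ> f) V = c" if "c \<in> colorings E V C" for c
      using that g fW by (auto simp: colorings_def fun_eq_iff PiE_iff extensional_def)
  qed
  then show ?thesis using bij_betw_same_card by fastforce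
qed

text \<open>Tails and heads in \<open>with_proj\<close> are the projections, so the vertex map of an
  isomorphism determines its arc map on arcs.\<close>

lemma digraph_iso_pair_iff:
  assumes "pair_wf_digraph G" "pair_wf_digraph H"
  shows "digraph_iso (with_proj G) (with_proj H) \<longleftrightarrow>
    (\<exists>f. bij_betw f (pverts G) (pverts H) \<and>
      (\<forall>u\<in>pverts G. \<forall>v\<in>pverts G. (u, v) \<in> parcs G \<longleftrightarrow> (f u, f v) \<in> parcs H))" (is "?L \<longleftrightarrow> ?R")
proof
  interpret G: pair_wf_digraph G by (rule assms(1))
  interpret H: pair_wf_digraph H by (rule assms(2))
  {
    assume ?L
    then obtain h where h: "pre_digraph.digraph_isomorphism (with_proj G) h"
        "with_proj H = app_iso h (with_proj G)"
      unfolding digraph_iso_def by blast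
    let ?f = "iso_verts h"
    have inj: "inj_on ?f (pverts G)"
      using h(1) unfolding pre_digraph.digraph_isomorphism_def by simp
    have V: "pverts H = ?f ` pverts G" using arg_cong[OF h(2), of verts] by simp
    have tl: "iso_tail h = fst" "iso_head h = snd"
      using arg_cong[OF h(2), of tail] arg_cong[OF h(2), of head] by simp_all
    have "iso_arcs h (u, v) = (?f u, ?f v)" if "(u, v) \<in> parcs G" for u v
      using h(1) that unfolding pre_digraph.digraph_isomorphism_def tl
      by (auto intro: prod_eqI)
    then have arcs: "parcs H = map_prod ?f ?f ` parcs G"
      using arg_cong[OF h(2), of arcs] by (force simp: image_iff)
    have "(u, v) \<in> parcs G \<longleftrightarrow> (?f u, ?f v) \<in> parcs H" if "u \<in> pverts G" "v \<in> pverts G" for u v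
      unfolding arcs using that inj by (auto dest: inj_onD G.in_arcsD1 G.in_arcsD2 intro: rev_image_eqI)
    then show ?R using inj V by (auto simp: bij_betw_def)
  next
    assume ?R
    then obtain f where f: "bij_betw f (pverts G) (pverts H)"
      "\<And>u v. u \<in> pverts G \<Longrightarrow> v \<in> pverts G \<Longrightarrow> (u, v) \<in> parcs G \<longleftrightarrow> (f u, f v) \<in> parcs H"
      by blast
    let ?h = "\<lparr> iso_verts = f, iso_arcs = map_prod f f, iso_head = snd, iso_tail = fst \<rparr>"
    have inj: "inj_on f (pverts G)" and V: "pverts H = f ` pverts G"
      using f(1) by (auto simp: bij_betw_def)
    have "inj_on (map_prod f f) (parcs G)"
    proof (rule inj_onI, clarify)
      fix u v u' v' assume *: "(u, v) \<in> parcs G" "(u', v') \<in> parcs G"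
        "map_prod f f (u, v) = map_prod f f (u', v')"
      then have "f u = f u'" "f v = f v'" by simp_all
      then show "u = u' \<and> v = v'"
        using inj_onD[OF inj] G.in_arcsD1[OF *(1)] G.in_arcsD1[OF *(2)]
          G.in_arcsD2[OF *(1)] G.in_arcsD2[OF *(2)] by blast
    qed
    then have "pre_digraph.digraph_isomorphism (with_proj G) ?h"
      using inj G.wf_digraph_axioms unfolding pre_digraph.digraph_isomorphism_def by simp
    moreover have "parcs H = map_prod f f ` parcs G"
    proof
      show "map_prod f f ` parcs G \<subseteq> parcs H"
      proof (rule image_subsetI)
        fix e assume "e \<in> parcs G"
        then show "map_prod f f e \<in> parcs H"
          using f(2)[of "fst e" "snd e"] G.in_arcsD1[of "fst e" "snd e"]
            G.in_arcsD2[of "fst e" "snd e"] by (cases e) simp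
      qed
      show "parcs H \<subseteq> map_prod f f ` parcs G"
      proof clarify
        fix u v assume uv: "(u, v) \<in> parcs H"
        then obtain u' v' where u'v': "u' \<in> pverts G" "v' \<in> pverts G" "u = f u'" "v = f v'"
          using H.in_arcsD1[OF uv] H.in_arcsD2[OF uv] V by auto
        then have "(u', v') \<in> parcs G" using f(2) uv by blast
        then show "(u, v) \<in> map_prod f f ` parcs G"
          using u'v' by (intro image_eqI[of _ _ "(u', v')"]) simp_all
      qed
    qed
    then have "with_proj H = app_iso ?h (with_proj G)"
      using V by (simp add: app_iso_def with_proj_def)
    ultimately show ?L unfolding digraph_iso_def by blast
  }
qed

section \<open>Chromatic number, independence number and connectedness of pair graphs\<close>

lemma adjacency_parcs: "pair_graph G \<Longrightarrow> adjacency (parcs G)"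
proof -
  assume "pair_graph G"
  then interpret pair_graph G .
  show ?thesis
  proof
    show "sym (parcs G)" using pair_sym_arcs by (simp add: symmetric_def)
    show "irrefl (parcs G)" unfolding irrefl_def using pair_no_loops by fastforce
  qed
qed

lemma chromatic_poly_eq_card_colorings:
  assumes "pair_graph G"
  shows "chromatic_poly G x = card (colorings (parcs G) (pverts G) {1..x})"
proof -
  interpret pair_graph G by fact
  have "proper_colorings G x = colorings (parcs G) (pverts G) {1..x}"
    using in_arcsD1 in_arcsD2 by (auto simp: proper_colorings_def colorings_def proper_on_def)
  then show ?thesis by (simp add: chromatic_poly_def)
qed

text \<open>Links colorings by arbitrary naturals to the palettes \<open>{1..q}\<close> of
  \<open>chromatic_number\<close>, by renumbering the colors in use.\<close>

lemma proper_colorings_nonempty: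
  fixes c :: "'a \<Rightarrow> nat"
  assumes "pair_graph G" "proper_on (parcs G) (pverts G) c"
  shows "proper_colorings G (card (c ` pverts G)) \<noteq> {}"
proof -
  interpret pair_graph G by fact
  have "finite (c ` pverts G)" using pair_finite_verts by simp
  then obtain h where h: "bij_betw h (c ` pverts G) {1..card (c ` pverts G)}"
    by (metis card_atLeastAtMost diff_Suc_1 finite_atLeastAtMost finite_same_card_bij)
  have "restrict (h \<circ> c) (pverts G) \<in> proper_colorings G (card (c ` pverts G))"
  proof -
    have "h (c u) \<in> {1..card (c ` pverts G)}" if "u \<in> pverts G" for u
      using h that by (auto simp: bij_betw_def)
    moreover have "h (c u) \<noteq> h (c v)" if "(u, v) \<in> parcs G" for u v
      using that in_arcsD1[OF that] in_arcsD2[OF that] assms(2) h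
      by (auto simp: proper_on_def bij_betw_def inj_on_def)
    ultimately show ?thesis using in_arcsD1 in_arcsD2 by (auto simp: proper_colorings_def)
  qed
  then show ?thesis by blast
qed

lemma needs_colors_chromatic_number:
  assumes "pair_graph G"
  shows "needs_colors (parcs G) (pverts G) (chromatic_number G)"
  unfolding needs_colors_def chromatic_number_def
  using proper_colorings_nonempty[OF assms] by (auto intro: Least_le)

lemma no_indep_triple_parcs:
  assumes "pair_graph G" "independence_number G \<le> 2"
  shows "no_indep_triple (parcs G) (pverts G)"
  unfolding no_indep_triple_def
proof (intro ballI impI)
  fix u v w assume V: "u \<in> pverts G" "v \<in> pverts G" "w \<in> pverts G"
    and ne: "u \<noteq> v \<and> v \<noteq> w \<and> u \<noteq> w"
  interpret pair_graph G by fact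
  interpret adjacency "parcs G" by (rule adjacency_parcs) fact
  show "(u, v) \<in> parcs G \<or> (v, w) \<in> parcs G \<or> (u, w) \<in> parcs G"
  proof (rule ccontr)
    assume "\<not> ?thesis"
    then have "independent_set G {u, v, w}"
      using V adj_sym by (auto simp: independent_set_def)
    moreover have "finite {S. independent_set G S}"
      using pair_finite_verts by (rule finite_subset[rotated, OF finite_Pow_iff[THEN iffD2]])
        (auto simp: independent_set_def)
    ultimately have "card {u, v, w} \<le> independence_number G"
      unfolding independence_number_def by (intro Max_ge) auto
    then show False using ne assms(2) by simp
  qed
qed

lemma card_le_twice_chromatic_number:
  assumes "pair_graph G" "independence_number G \<le> 2"
  shows "card (pverts G) \<le> 2 * chromatic_number G"
proof -
  interpret pair_graph G by fact
  interpret adjacency "parcs G" by (rule adjacency_parcs) fact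
  let ?k = "chromatic_number G"
  obtain g :: "'a \<Rightarrow> nat" where "inj_on g (pverts G)"
    using finite_imp_inj_to_nat_seg[OF pair_finite_verts] by blast
  then have "proper_on (parcs G) (pverts G) g" by (rule proper_on_inj)
  \<comment> \<open>The injective coloring shows that some palette suffices, so the
    \<open>LEAST\<close> is attained.\<close>
  then have "proper_colorings G ?k \<noteq> {}"
    unfolding chromatic_number_def
    by (rule LeastI[of "\<lambda>q. proper_colorings G q \<noteq> {}", OF proper_colorings_nonempty[OF assms(1)]])
  then obtain c where c: "c \<in> proper_colorings G ?k" by blast
  have "proper_on (parcs G) (pverts G) c" and sub: "c ` pverts G \<subseteq> {1..?k}"
    using c by (auto simp: proper_colorings_def proper_on_def)
  then have "card (pverts G) \<le> 2 * card (c ` pverts G)"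
    using pair_finite_verts no_indep_triple_parcs[OF assms] by (intro card_le_twice_colors)
  also have "\<dots> \<le> 2 * ?k" using card_mono[OF _ sub] by simp
  finally show ?thesis .
qed

text \<open>With no crossing arc in either direction, \<open>A\<close> is closed under the arcs of
  \<open>mk_symmetric H\<close> and contains everything reachable from it. \<open>connected\<close>
  refers to that symmetric closure, hence the two directions.\<close>

lemma connected_crossing_arc:
  assumes "Digraph_Component.connected H" "A \<subseteq> verts H" "A \<noteq> {}" "verts H - A \<noteq> {}"
  shows "\<exists>e\<in>arcs H. (tail H e \<in> A \<and> head H e \<in> verts H - A) \<or>
    (head H e \<in> A \<and> tail H e \<in> verts H - A)"
proof (rule ccontr)
  assume none: "\<not> ?thesis"
  obtain a b where ab: "a \<in> A" "b \<in> verts H - A" using assms(3,4) by blast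
  then have "(a, b) \<in> rtrancl_on (verts H) (parcs (mk_symmetric H))"
    using assms(1,2)
    unfolding Digraph_Component.connected_def strongly_connected_def reachable_def by auto
  then have "b \<in> A"
  proof (induction rule: rtrancl_on_induct)
    case (step y z)
    then show ?case using none unfolding parcs_mk_symmetric by fastforce
  qed (use ab in simp)
  then show False using ab by simp
qed

text \<open>The cut criterion for the graph without \<open>w\<close>; since \<open>A\<close> may
  contain \<open>w\<close>, it is removed from both sides.\<close>

lemma two_connected_crossing:
  assumes "pair_graph G" "two_connected G" "w \<in> pverts G" "A \<subseteq> pverts G"
    "A - {w} \<noteq> {}" "pverts G - A - {w} \<noteq> {}"
  shows "\<exists>p\<in>A - {w}. \<exists>q\<in>pverts G - A - {w}. (p, q) \<in> parcs G"
proof -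
  interpret adjacency "parcs G" by (rule adjacency_parcs) fact
  let ?H = "pre_digraph.del_vert (with_proj G) w"
  have conn: "Digraph_Component.connected ?H" using assms(2,3) by (simp add: two_connected_def)
  have H: "verts ?H = pverts G - {w}" "tail ?H = fst" "head ?H = snd" "arcs ?H \<subseteq> parcs G"
    by (auto simp: pre_digraph.del_vert_def)
  have A: "A - {w} \<subseteq> verts ?H" "verts ?H - (A - {w}) = pverts G - A - {w}"
    using assms(4) H(1) by auto
  then obtain e where "e \<in> parcs G" "(fst e \<in> A - {w} \<and> snd e \<in> pverts G - A - {w}) \<or>
      (snd e \<in> A - {w} \<and> fst e \<in> pverts G - A - {w})"
    using connected_crossing_arc[OF conn A(1) assms(5)] assms(6) H(2-4) unfolding A(2) by auto
  then show ?thesis using adj_sym by (metis prod.collapse)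
qed

lemma connected_pair_crossing:
  assumes "pair_graph G" "two_connected G" "A \<subseteq> pverts G" "A \<noteq> {}" "pverts G - A \<noteq> {}"
  shows "\<exists>p\<in>A. \<exists>q\<in>pverts G - A. (p, q) \<in> parcs G"
proof -
  interpret adjacency "parcs G" by (rule adjacency_parcs) fact
  have "Digraph_Component.connected (with_proj G)" using assms(2) by (simp add: two_connected_def)
  then obtain e where "e \<in> parcs G" "(fst e \<in> A \<and> snd e \<in> pverts G - A) \<or>
      (snd e \<in> A \<and> fst e \<in> pverts G - A)"
    using connected_crossing_arc[of "with_proj G" A] assms(3-5) by auto
  then show ?thesis using adj_sym by (metis prod.collapse)
qed

section \<open>The graphs \<open>G_{k+1,k}\<close> and \<open>G_{k+2,k}\<close>\<close>

lemma clique_path_graph_Suc: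
  "pverts (clique_path_graph (k + 1) k) = {..<k + 1}"
  "parcs (clique_path_graph (k + 1) k) =
    {(u, v). u < k \<and> v < k \<and> u \<noteq> v} \<union> {(0, k), (k, 1), (k, 0), (1, k)}"
  by (auto simp: clique_path_graph_def path_arcs_def)

lemma clique_path_graph_Suc_Suc:
  "pverts (clique_path_graph (k + 2) k) = {..<k + 2}"
  "parcs (clique_path_graph (k + 2) k) = {(u, v). u < k \<and> v < k \<and> u \<noteq> v} \<union>
    {(0, k), (k, k + 1), (k + 1, 1), (k, 0), (k + 1, k), (1, k + 1)}"
  by (auto simp: clique_path_graph_def path_arcs_def upt_rec[of _ "Suc _"])

lemma one_ear_clique_path_graph:
  assumes "2 \<le> k"
  shows "one_ear (parcs (clique_path_graph (k + 1) k)) (pverts (clique_path_graph (k + 1) k)) k"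
  unfolding one_ear_def clique_path_graph_Suc clique_on_def
  by (intro exI[of _ "{..<k}"] exI[of _ k] exI[of _ "0::nat"] exI[of _ "1::nat"])
    (use assms in auto)

lemma two_ear_clique_path_graph:
  assumes "2 \<le> k"
  shows "two_ear (parcs (clique_path_graph (k + 2) k)) (pverts (clique_path_graph (k + 2) k)) k"
  unfolding two_ear_def clique_path_graph_Suc_Suc clique_on_def
  by (intro exI[of _ "{..<k}"] exI[of _ k] exI[of _ "k + 1"] exI[of _ "0::nat"] exI[of _ "1::nat"])
    (use assms in auto)

text \<open>The vertices of a clique are interchangeable, so the ends of the ear can be numbered 0
  and 1, as in \<open>clique_path_graph\<close>.\<close>

lemma ex_bij_clique:
  assumes "finite K" "card K = k" "a \<in> K" "b \<in> K" "a \<noteq> b"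
  shows "\<exists>f. bij_betw f K {..<k} \<and> f a = 0 \<and> f b = (1::nat)"
proof -
  have "card (K - {a, b}) = card {2..<k}"
    using card_Diff_subset[of "{a, b}" K] assms by simp
  then obtain g where g: "bij_betw g (K - {a, b}) {2..<k}"
    using assms(1) by (metis finite_Diff finite_atLeastLessThan finite_same_card_bij)
  define f where "f u = (if u = a then 0 else if u = b then 1 else g u)" for u
  have "card {a, b} \<le> card K" using assms by (intro card_mono) auto
  then have k: "2 \<le> k" using assms by simp
  have "bij_betw f (K - {a, b}) {2..<k}"
    using g by (rule bij_betw_cong[THEN iffD1, rotated]) (simp add: f_def)
  moreover have "bij_betw f {a, b} {0, 1}" using assms(5) by (auto simp: bij_betw_def f_def)
  ultimately have "bij_betw f ((K - {a, b}) \<union> {a, b}) ({2..<k} \<union> {0, 1})"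
    by (rule bij_betw_combine) auto
  moreover have "(K - {a, b}) \<union> {a, b} = K" "{2..<k} \<union> {0, 1} = {..<k}" using assms k by auto
  ultimately show ?thesis using assms(5) by (auto simp: f_def)
qed

lemma digraph_iso_one_ear:
  assumes G: "pair_graph G" and k: "2 \<le> k" and ear: "one_ear (parcs G) (pverts G) k"
  shows "digraph_iso (with_proj G) (with_proj (clique_path_graph (k + 1) k))"
proof -
  interpret pair_graph G by fact
  interpret adjacency "parcs G" by (rule adjacency_parcs) fact
  note cpg = clique_path_graph_Suc[simplified]
  obtain K z a b where K: "pverts G = insert z K" "z \<notin> K" "clique_on (parcs G) K" "card K = k"
      "a \<noteq> b" and N: "{w \<in> K. (z, w) \<in> parcs G} = {a, b}"
    using ear unfolding one_ear_def by blast
  have ab: "a \<in> K" "b \<in> K" using N by auto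
  have finK: "finite K" using pair_finite_verts K(1) by simp
  obtain h where h: "bij_betw h K {..<k}" "h a = 0" "h b = 1"
    using ex_bij_clique[OF finK K(4) ab K(5)] by blast
  define f where "f = h(z := k)"
  have fz: "f z = k" by (simp add: f_def)
  have fh: "f u = h u" if "u \<in> K" for u using that K(2) by (auto simp: f_def)
  have f: "bij_betw f (pverts G) {..<k + 1}"
  proof -
    have "bij_betw f K {..<k}" using h(1) fh bij_betw_cong by metis
    then have "bij_betw f (K \<union> {z}) ({..<k} \<union> {f z})"
      by (rule notIn_Un_bij_betw[OF K(2), rotated]) (simp add: fz)
    then show ?thesis by (simp add: K(1) fz lessThan_Suc)
  qed
  have hk: "h u < k" if "u \<in> K" for u using h(1) that by (auto simp: bij_betw_def)
  have heq: "h u = h v \<longleftrightarrow> u = v" if "u \<in> K" "v \<in> K" for u v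
    using h(1) that by (auto simp: bij_betw_def inj_on_def)
  have adjz: "(z, u) \<in> parcs G \<longleftrightarrow> h u = 0 \<or> h u = 1" if "u \<in> K" for u
  proof -
    have "(z, u) \<in> parcs G \<longleftrightarrow> u \<in> {a, b}" using N that by blast
    then show ?thesis using heq[OF that] ab h by (metis insert_iff singletonD)
  qed
  have "(u, v) \<in> parcs G \<longleftrightarrow> (f u, f v) \<in> parcs (clique_path_graph (k + 1) k)"
    if uv: "u \<in> pverts G" "v \<in> pverts G" for u v
  proof -
    consider "u = z" "v = z" | "u = z" "v \<in> K" | "u \<in> K" "v = z" | "u \<in> K" "v \<in> K"
      using uv K(1) by blast
    then show ?thesis
    proof cases
      case 1 then show ?thesis using k by (simp add: cpg fz)
    next
      case 2
      then show ?thesis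
        using adjz[of v] hk[of v] k by (auto simp: cpg fz fh)
    next
      case 3
      then show ?thesis
        using adjz[of u] hk[of u] k adj_sym[of u z] by (auto simp: cpg fz fh)
    next
      case 4
      then have "(u, v) \<in> parcs G \<longleftrightarrow> u \<noteq> v" using K(3) by (auto simp: clique_on_def)
      then show ?thesis
        using 4 hk[of u] hk[of v] heq[of u v] by (auto simp: cpg fh)
    qed
  qed
  moreover have "pair_graph (clique_path_graph (k + 1) k)"
    using k by (intro pair_graph_clique_path_graph) auto
  then have "pair_wf_digraph (clique_path_graph (k + 1) k)"
    by (simp add: pair_graph_def pair_digraph_def pair_fin_digraph_def)
  ultimately show ?thesis
    using f digraph_iso_pair_iff[OF pair_wf_digraph_axioms] clique_path_graph_Suc(1) by metis
qed

lemma digraph_iso_two_ear: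
  assumes G: "pair_graph G" and k: "2 \<le> k" and ear: "two_ear (parcs G) (pverts G) k"
  shows "digraph_iso (with_proj G) (with_proj (clique_path_graph (k + 2) k))"
proof -
  interpret pair_graph G by fact
  interpret adjacency "parcs G" by (rule adjacency_parcs) fact
  note cpg = clique_path_graph_Suc_Suc[simplified]
  obtain K y z a b where K: "pverts G = insert z (insert y K)" "y \<notin> K" "z \<notin> K" "y \<noteq> z"
      "clique_on (parcs G) K" "card K = k" "a \<noteq> b" and yz: "(y, z) \<in> parcs G"
      and N: "{w \<in> K. (y, w) \<in> parcs G} = {a}" "{w \<in> K. (z, w) \<in> parcs G} = {b}"
    using ear unfolding two_ear_def by blast
  have ab: "a \<in> K" "b \<in> K" using N by auto
  have zy: "(z, y) \<in> parcs G" using yz by (simp only: adj_sym[of z y])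
  have finK: "finite K" using pair_finite_verts K(1) by simp
  obtain h where h: "bij_betw h K {..<k}" "h a = 0" "h b = 1"
    using ex_bij_clique[OF finK K(6) ab K(7)] by blast
  \<comment> \<open>The path of \<open>clique_path_graph\<close> runs \<open>0, k, k + 1, 1\<close>:
    \<open>y\<close> hangs on \<open>a\<close>, numbered 0, and \<open>z\<close> on
    \<open>b\<close>, numbered 1.\<close>
  define f where "f = h(y := k, z := k + 1)"
  have fy: "f y = k" and fz: "f z = k + 1" using K(4) by (auto simp: f_def)
  have fh: "f u = h u" if "u \<in> K" for u using that K(2,3) by (auto simp: f_def)
  have f: "bij_betw f (pverts G) {..<k + 2}"
  proof -
    have "bij_betw f K {..<k}" using h(1) fh bij_betw_cong by metis
    then have "bij_betw f (K \<union> {y}) ({..<k} \<union> {f y})"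
      by (rule notIn_Un_bij_betw[OF K(2), rotated]) (simp add: fy)
    then have "bij_betw f (insert y K \<union> {z}) (({..<k} \<union> {f y}) \<union> {f z})"
      using K(3,4) by (intro notIn_Un_bij_betw) (auto simp: fy fz)
    moreover have "({..<k} \<union> {f y}) \<union> {f z} = {..<k + 2}" by (auto simp: fy fz)
    ultimately show ?thesis by (simp add: K(1))
  qed
  have hk: "h u < k" if "u \<in> K" for u using h(1) that by (auto simp: bij_betw_def)
  have heq: "h u = h v \<longleftrightarrow> u = v" if "u \<in> K" "v \<in> K" for u v
    using h(1) that by (auto simp: bij_betw_def inj_on_def)
  have adjy: "(y, u) \<in> parcs G \<longleftrightarrow> h u = 0" and adjz: "(z, u) \<in> parcs G \<longleftrightarrow> h u = 1"
    if "u \<in> K" for u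
  proof -
    have "(y, u) \<in> parcs G \<longleftrightarrow> u = a" "(z, u) \<in> parcs G \<longleftrightarrow> u = b" using N that by blast+
    then show "(y, u) \<in> parcs G \<longleftrightarrow> h u = 0" "(z, u) \<in> parcs G \<longleftrightarrow> h u = 1"
      using heq[OF that] ab h by metis+
  qed
  have "(u, v) \<in> parcs G \<longleftrightarrow> (f u, f v) \<in> parcs (clique_path_graph (k + 2) k)"
    if uv: "u \<in> pverts G" "v \<in> pverts G" for u v
  proof -
    consider "u \<in> {y, z}" "v \<in> {y, z}" | "u = y" "v \<in> K" | "u = z" "v \<in> K"
      | "u \<in> K" "v = y" | "u \<in> K" "v = z" | "u \<in> K" "v \<in> K"
      using uv K(1) by blast
    then show ?thesis
    proof cases
      case 1
      then consider "u = y" "v = y" | "u = y" "v = z" | "u = z" "v = y" | "u = z" "v = z" by blast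
      then show ?thesis by cases (use k yz zy in \<open>simp_all add: cpg fy fz\<close>)
    next
      case 2
      then show ?thesis
        using adjy[of v] hk[of v] k by (auto simp: cpg fy fh)
    next
      case 3
      then show ?thesis
        using adjz[of v] hk[of v] k by (auto simp: cpg fz fh)
    next
      case 4
      then show ?thesis
        using adjy[of u] hk[of u] k adj_sym[of u y] by (auto simp: cpg fy fh)
    next
      case 5
      then show ?thesis
        using adjz[of u] hk[of u] k adj_sym[of u z] by (auto simp: cpg fz fh)
    next
      case 6
      then have "(u, v) \<in> parcs G \<longleftrightarrow> u \<noteq> v" using K(5) by (auto simp: clique_on_def)
      then show ?thesis
        using 6 hk[of u] hk[of v] heq[of u v] by (auto simp: cpg fh)
    qed
  qed
  moreover have "pair_graph (clique_path_graph (k + 2) k)"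
    using k by (intro pair_graph_clique_path_graph) auto
  then have "pair_wf_digraph (clique_path_graph (k + 2) k)"
    by (simp add: pair_graph_def pair_digraph_def pair_fin_digraph_def)
  ultimately show ?thesis
    using f digraph_iso_pair_iff[OF pair_wf_digraph_axioms] clique_path_graph_Suc_Suc(1) by metis
qed

lemma digraph_iso_invariants:
  assumes "pair_graph G" "pair_graph H" "digraph_iso (with_proj G) (with_proj H)"
  shows "card (pverts G) = card (pverts H)" "chromatic_poly G x = chromatic_poly H x"
proof -
  interpret G: pair_graph G by fact
  interpret H: pair_graph H by fact
  obtain f where f: "bij_betw f (pverts G) (pverts H)"
    "\<And>u v. u \<in> pverts G \<Longrightarrow> v \<in> pverts G \<Longrightarrow> (u, v) \<in> parcs G \<longleftrightarrow> (f u, f v) \<in> parcs H"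
    using assms(3) digraph_iso_pair_iff[OF G.pair_wf_digraph_axioms H.pair_wf_digraph_axioms] by blast
  show "card (pverts G) = card (pverts H)" using f(1) by (rule bij_betw_same_card)
  show "chromatic_poly G x = chromatic_poly H x"
    using card_colorings_bij[OF f] assms(1,2) by (simp add: chromatic_poly_eq_card_colorings)
qed

text \<open>For the converse of the equality case: both graphs are cliques with an ear, where the
  counts are exact.\<close>

lemma chromatic_poly_clique_path_graph:
  assumes "2 \<le> k" "k \<le> x"
  shows "int (chromatic_poly (clique_path_graph (k + 1) k) x)
      = int (ffact_nat x k) * ear_colorings (int x) 1"
    "int (chromatic_poly (clique_path_graph (k + 2) k) x)
      = int (ffact_nat x k) * ear_colorings (int x) 2"
proof -
  have g: "pair_graph (clique_path_graph (k + 1) k)" "pair_graph (clique_path_graph (k + 2) k)"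
    using assms by (intro pair_graph_clique_path_graph; simp)+
  interpret one: adjacency "parcs (clique_path_graph (k + 1) k)" by (rule adjacency_parcs) (rule g)
  interpret two: adjacency "parcs (clique_path_graph (k + 2) k)" by (rule adjacency_parcs) (rule g)
  have fin: "finite (pverts (clique_path_graph (k + s) k))" for s
    by (simp add: clique_path_graph_def)
  have "chromatic_poly (clique_path_graph (k + 1) k) x = ffact_nat x k * (x - 2)"
    using one.card_colorings_one_ear[OF fin _ one_ear_clique_path_graph[OF assms(1)], of "{1..x}"]
    unfolding chromatic_poly_eq_card_colorings[OF g(1)] by simp
  moreover have "ear_colorings (int x) 1 = int (x - 2)" using assms by (simp add: of_nat_diff)
  ultimately show "int (chromatic_poly (clique_path_graph (k + 1) k) x)
      = int (ffact_nat x k) * ear_colorings (int x) 1" by (simp only: of_nat_mult)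
  have "chromatic_poly (clique_path_graph (k + 2) k) x = ffact_nat x k * ((x - 1) * (x - 2) + 1)"
    using two.card_colorings_two_ear[OF fin _ two_ear_clique_path_graph[OF assms(1)], of "{1..x}"] assms
    unfolding chromatic_poly_eq_card_colorings[OF g(2)] by simp
  then show "int (chromatic_poly (clique_path_graph (k + 2) k) x)
      = int (ffact_nat x k) * ear_colorings (int x) 2"
    using ear_colorings_2[of x] assms by (simp only: of_nat_mult)
qed

theorem theorem3p12:
  fixes G :: "'a pair_pre_digraph" and n k x :: nat
  assumes "k \<ge> 4" and "n > k"
    and "pair_graph G"
    and "two_connected G"
    and "card (pverts G) = n"
    and "chromatic_number G = k"
    and "independence_number G = 2"
    and "x \<ge> k"
  shows "int (chromatic_poly G x)
           \<le> falling_fact (int x - 1) (k - 1) * ((int x - 1) ^ (n - k + 1) + (- 1) ^ (n - k))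
       \<and> (int (chromatic_poly G x)
             = falling_fact (int x - 1) (k - 1) * ((int x - 1) ^ (n - k + 1) + (- 1) ^ (n - k))
          \<longleftrightarrow> digraph_iso (with_proj G) (with_proj (clique_path_graph (k + 1) k))
            \<or> digraph_iso (with_proj G) (with_proj (clique_path_graph (k + 2) k)))"
proof -
  interpret pair_graph G by fact
  interpret adjacency "parcs G" by (rule adjacency_parcs) fact
  define t where "t = n - k"
  let ?F = "int (ffact_nat x k) * ear_colorings (int x) t"
  have F: "falling_fact (int x - 1) (k - 1) * ((int x - 1) ^ (n - k + 1) + (- 1) ^ (n - k)) = ?F"
    using bound_eq_ear_colorings[of k x t] assms(1,8) by (simp add: t_def)
  have P: "chromatic_poly G x = card (colorings (parcs G) (pverts G) {1..x})"
    by (rule chromatic_poly_eq_card_colorings) fact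
  \<comment> \<open>This is \<open>t \<le> k\<close>.\<close>
  have "n \<le> 2 * k" using card_le_twice_chromatic_number[OF assms(3)] assms(5-7) by simp
  then have "int (card (colorings (parcs G) (pverts G) {1..x}))
      \<le> int (ffact_nat (card {1..x}) k) * ear_colorings (int (card {1..x})) t \<and>
    (int (card (colorings (parcs G) (pverts G) {1..x}))
      = int (ffact_nat (card {1..x}) k) * ear_colorings (int (card {1..x})) t
      \<longrightarrow> one_ear (parcs G) (pverts G) k \<or> two_ear (parcs G) (pverts G) k)"
    using no_indep_triple_parcs[OF assms(3)] needs_colors_chromatic_number[OF assms(3)]
      connected_pair_crossing[OF assms(3,4)] two_connected_crossing[OF assms(3,4)]
      pair_finite_verts assms
    by (intro card_colorings_le_ear_colorings) (simp_all add: t_def)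
  then have le: "int (chromatic_poly G x) \<le> ?F"
    and eq: "int (chromatic_poly G x) = ?F \<Longrightarrow>
      one_ear (parcs G) (pverts G) k \<or> two_ear (parcs G) (pverts G) k"
    by (simp_all add: P)
  \<comment> \<open>Counting vertices forces \<open>n = k + s\<close>, so \<open>?F\<close> is the
    value at \<open>t = s\<close> and not at another length of the ear.\<close>
  have "int (chromatic_poly G x) = ?F"
    if iso: "digraph_iso (with_proj G) (with_proj (clique_path_graph (k + s) k))" "s = 1 \<or> s = 2" for s
  proof -
    have "pair_graph (clique_path_graph (k + s) k)"
      using assms(1) by (intro pair_graph_clique_path_graph) auto
    note inv = digraph_iso_invariants[OF assms(3) this iso(1)]
    have "n = k + s" using inv(1) assms(5) by (simp add: clique_path_graph_def)
    then show ?thesis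
      using inv(2) chromatic_poly_clique_path_graph[of k x] iso(2) assms(1,8) by (auto simp: t_def)
  qed
  then have "int (chromatic_poly G x) = ?F
      \<longleftrightarrow> digraph_iso (with_proj G) (with_proj (clique_path_graph (k + 1) k))
        \<or> digraph_iso (with_proj G) (with_proj (clique_path_graph (k + 2) k))"
    using eq digraph_iso_one_ear[OF assms(3)] digraph_iso_two_ear[OF assms(3)] assms(1) by fastforce
  then show ?thesis using le unfolding F by blast
qed

end
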